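(* Let $q \in \mathbb{N}$ and $b_1,\dots,b_q \in \mathbb{C}$. Suppose the $b_j$ are indexed as follows: there are integers $r \geq 1$ and $n_1,\dots,n_r \geq 1$ with $\sum_{s=1}^r n_s = q$ such that, writing $N_s = n_1+\cdots+n_{s-1}$ (so $N_1=0$) and $B_s = \{b_{N_s+1},\dots,b_{N_s+n_s}\}$ for $1 \leq s \leq r$, (i) $b_j - b_{j'} \in \mathbb{Z}$ whenever $b_j, b_{j'}$ lie in the same block $B_s$, and $b_j - b_{j'} \notin \mathbb{Z}$ whenever they lie in different blocks (i.e., the blocks are the congruence classes of the multiset $\{b_1,\dots,b_q\}$ modulo $\mathbb{Z}$); (ii) within each block, $\Re(b_{N_s+1}) \geq \Re(b_{N_s+2}) \geq \cdots \geq \Re(b_{N_s+n_s})$. For $1 \leq s \leq r$ and $1 \leq k \leq n_s$ define $$y_{N_s+k}(\zeta) = G^{k,0}_{0,q}\left(\begin{array}{c} \\ b_{N_s+1},\dots,b_{N_s+k};\ (b_j)_{j \notin \{N_s+1,\dots,N_s+k\}} \end{array}\Bigg|\ (-1)^k \zeta\right),$$ where the second group of lower parameters consists of all $b_j$ with $j \in \{1,\dots,q\}\setminus\{N_s+1,\dots,N_s+k\}$. Then $y_1,\dots,y_q$ form a fundamental system of solutions of the $q$th-order differential equation $$\Bigg[\prod_{j=1}^q \bigg(\zeta \frac{d}{d\zeta} - b_j\bigg) - \zeta\Bigg] u(\zeta) = 0, \quad \zeta \in \mathbb{C}\setminus\{0\}.$$ Moreover, for $k=1$, $$y_{N_s+1}(\zeta)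 = \frac{(-\zeta)^{b_{N_s+1}}}{\prod_{j'=1}^q \Gamma(1+b_{N_s+1}-b_{j'})}\, {}_0F_{q-1}\left(\begin{array}{c} \\ (1+b_{N_s+1}-b_j)_{1\le j\le q,\ j \neq N_s+1}\end{array}\Bigg|\ \zeta\right).$$
   Context: Meijer's $G$-function: for $1 \leq m \leq q$ and $c_1,\dots,c_q \in \mathbb{C}$, $$G^{m,0}_{0,q}\left(\begin{array}{c} \\ c_1,\dots,c_m; c_{m+1},\dots,c_q\end{array}\Bigg|\ x\right) = \frac{1}{2\pi i}\int_{\mathcal{C}} d\omega\, \frac{\prod_{j=1}^m \Gamma(c_j-\omega)}{\prod_{j=m+1}^q \Gamma(1-c_j+\omega)}\, x^{\omega},$$ where $\mathcal{C}$ is a contour beginning and ending at $+\infty$ encircling all poles of $\Gamma(c_j-\cdot)$, $1\le j\le m$, once in the negative direction; the integral is defined as the (absolutely convergent) sum of the residues, i.e. minus the sum over these poles of the residues of the integrand. Here $x^\omega = e^{\omega \log x}$ for a fixed branch of the logarithm (on $\mathbb{C}$ minus a cut from $0$ to $\infty$), and $(-\zeta)^{b} = e^{b\log(-\zeta)}$ uses the same branch. The value does not depend on the order of the parameters within each of the two groups. The generalized hypergeometric function is ${}_0F_{q-1}\left(\begin{array}{c} \\ \beta_1,\dots,\beta_{q-1}\end{array}\big|\ \zeta\right) = \sum_{k\ge 0} \frac{\zeta^k}{k!\prod_{m=1}^{q-1}(\beta_m)_k}$, with Pochhammer symbol $(\gamma)_0=1$, $(\gamma)_k = \gamma(\gamma+1)\cdots(\gamma+k-1)$.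 A fundamental system of solutions means $q$ linearly independent solutions (on a simply connected subdomain of $\mathbb{C}\setminus\{0\}$ where the branches are fixed). *)

theory Defs
  imports "HOL-Complex_Analysis.Complex_Analysis"
begin

definition log_cut :: "complex \<Rightarrow> complex set" where
  "log_cut w = {complex_of_real t * w | t. t \<ge> 0}"

text \<open>Integrand of Meijer's G-function G^{m,0}_{0,q}; cs = first group (c_1..c_m),
  ds = second group (c_{m+1}..c_q); x^omega = exp(omega * L x) for the branch L.\<close>
definition meijerG_integrand ::
  "(complex \<Rightarrow> complex) \<Rightarrow> complex list \<Rightarrow> complex list \<Rightarrow> complex \<Rightarrow> complex \<Rightarrow> complex" where
  "meijerG_integrand L cs ds x =
     (\<lambda>\<omega>. (\<Prod>c\<leftarrow>cs. Gamma (c - \<omega>)) / (\<Prod>d\<leftarrow>ds. Gamma (1 - d + \<omega>)) * exp (\<omega> * L x))"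

definition meijerG_poles :: "complex list \<Rightarrow> complex set" where
  "meijerG_poles cs = {c + of_nat k | c k. c \<in> set cs}"

definition meijerG ::
  "(complex \<Rightarrow> complex) \<Rightarrow> complex list \<Rightarrow> complex list \<Rightarrow> complex \<Rightarrow> complex" where
  "meijerG L cs ds x = - infsum (\<lambda>p. residue (meijerG_integrand L cs ds x) p) (meijerG_poles cs)"

definition hyp0F :: "complex list \<Rightarrow> complex \<Rightarrow> complex" where
  "hyp0F \<beta>s z = (\<Sum>k. z ^ k / (fact k * (\<Prod>\<beta>\<leftarrow>\<beta>s. pochhammer \<beta> k)))"

definition blk_start :: "(nat \<Rightarrow> nat) \<Rightarrow> nat \<Rightarrow> nat" where
  "blk_start n s = (\<Sum>t=1..<s. n t)"

definition meijer_sol ::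
  "(complex \<Rightarrow> complex) \<Rightarrow> (nat \<Rightarrow> complex) \<Rightarrow> nat \<Rightarrow> (nat \<Rightarrow> nat) \<Rightarrow> nat \<Rightarrow> nat \<Rightarrow> complex \<Rightarrow> complex" where
  "meijer_sol L b q n s k = (\<lambda>\<zeta>.
     meijerG L (map b [blk_start n s + 1..<blk_start n s + k + 1])
       (map b (filter (\<lambda>j. j \<notin> {blk_start n s + 1..blk_start n s + k}) [1..<q+1]))
       ((-1) ^ k * \<zeta>))"

definition euler_op :: "complex \<Rightarrow> (complex \<Rightarrow> complex) \<Rightarrow> complex \<Rightarrow> complex" where
  "euler_op b f = (\<lambda>z. z * deriv f z - b * f z)"

definition euler_prod :: "complex list \<Rightarrow> (complex \<Rightarrow> complex) \<Rightarrow> complex \<Rightarrow> complex" where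
  "euler_prod bs f = foldr euler_op bs f"

end

theory Submission
  imports Defs
begin

text \<open>
  Write the integrand of a solution as \<open>H \<omega> exp (\<omega> l)\<close> with \<open>l = L x\<close>, where \<open>H\<close> is a quotient of
  Gamma functions whose poles lie on the ray \<open>\<beta>, \<beta> + 1, \<beta> + 2, \<dots>\<close>. Minus the solution is then an
  entire function \<open>\<Phi> l\<close>, the sum of the residues along that ray, and differentiating in \<open>l\<close>
  multiplies the integrand by \<open>\<omega>\<close>. Since \<open>\<zeta> d/d\<zeta>\<close> acts as \<open>d/dl\<close>, the differential equation is the
  functional equation of \<open>H\<close> under \<open>\<omega> \<mapsto> \<omega> - 1\<close>, no residue being lost because \<open>\<beta> - 1\<close> is not a pole.

  For linear independence, a vanishing combination of the solutions vanishes for all complex \<open>l\<close>.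
  The shift \<open>l \<mapsto> l + 2\<pi>i\<close> multiplies the integrand by \<open>e(\<omega>) = exp (2\<pi>i \<omega>)\<close>, so a suitable
  polynomial in this shift multiplies it by a product of powers of \<open>e(\<omega>) - e(b)\<close>. The exponents can
  be chosen to cancel all poles except those of the top term of one block, which become simple;
  what remains is a nonzero power series in \<open>exp l\<close>.
\<close>

section \<open>Residue series along a ray, and kernels of rapid decay\<close>

definition ray :: "complex \<Rightarrow> complex set" where
  "ray \<beta> = range (\<lambda>i. \<beta> + of_nat i)"

text \<open>An ordered series, so that the rules for \<open>sums\<close> apply; it is identified
  with the unordered sum in \<open>meijerG\<close> once absolute convergence is known.\<close>

definition residue_sum :: "complex \<Rightarrow> (complex \<Rightarrow> complex) \<Rightarrow> complex" where
  "residue_sum \<beta> f = (\<Sum>i. residue f (\<beta> + of_nat i))"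

definition exp_type :: "(complex \<Rightarrow> complex) \<Rightarrow> bool" where
  "exp_type g \<longleftrightarrow> g holomorphic_on UNIV \<and> (\<exists>C A. A \<ge> 0 \<and> (\<forall>\<omega>. norm (g \<omega>) \<le> C * exp (A * norm \<omega>)))"

text \<open>The open unit disc around a point of the ray contains no other point of it, so the
  circle of radius 1/2 computes that single residue, and decay is asked for on these circles only.
  Decay against every ratio \<open>R\<close> makes the class stable under multiplication by
  functions of exponential type.\<close>

definition rapid_kernel :: "complex \<Rightarrow> (complex \<Rightarrow> complex) \<Rightarrow> bool" where
  "rapid_kernel \<beta> H \<longleftrightarrow> H holomorphic_on - ray \<beta> \<and>
     (\<forall>R\<ge>1. \<exists>M. \<forall>i. \<forall>\<omega>\<in>sphere (\<beta> + of_nat i) (1/2). norm (H \<omega>) \<le> M / R ^ i)"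

lemma ray_minus_singleton: "ball (\<beta> + of_nat i) 1 - {\<beta> + of_nat i} \<subseteq> - ray \<beta>"
proof
  fix x assume x: "x \<in> ball (\<beta> + of_nat i) 1 - {\<beta> + of_nat i}"
  have False if "x = \<beta> + of_nat j" for j
  proof -
    have "dist (of_nat i :: complex) (of_nat j) < 1" using x that by (simp add: dist_norm)
    then have "norm (of_int (int i - int j) :: complex) < 1"
      by (simp add: dist_norm)
    then have "i = j" by (subst (asm) norm_of_int) linarith
    then show False using x that by simp
  qed
  then show "x \<in> - ray \<beta>" by (auto simp: ray_def)
qed

lemma sphere_subset_ray_compl: "sphere (\<beta> + of_nat i) (1/2) \<subseteq> - ray \<beta>"
proof
  fix x assume "x \<in> sphere (\<beta> + of_nat i) (1/2)"
  then have "x \<in> ball (\<beta> + of_nat i) 1 - {\<beta> + of_nat i}" by auto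
  then show "x \<in> - ray \<beta>" using ray_minus_singleton by blast
qed

text \<open>Cauchy's estimate: the circle has length \<pi>, and division by 2\<pi> leaves the factor
  1/2.\<close>

lemma residue_le_of_sphere_bound:
  assumes hol: "f holomorphic_on - ray \<beta>"
    and bd: "\<And>\<omega>. \<omega> \<in> sphere (\<beta> + of_nat i) (1/2) \<Longrightarrow> norm (f \<omega>) \<le> B"
  shows "norm (residue f (\<beta> + of_nat i)) \<le> B / 2"
proof -
  let ?p = "\<beta> + of_nat i"
  have "(f has_contour_integral 2 * pi * \<i> * residue f ?p) (circlepath ?p (1/2))"
    by (rule base_residue[of "ball ?p 1"])
       (use hol ray_minus_singleton[of \<beta> i] in \<open>auto intro: holomorphic_on_subset\<close>)
  moreover have "B \<ge> 0"
    using order_trans[OF norm_ge_zero bd[of "?p + 1/2"]] by (simp add: dist_norm)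
  moreover have "norm (f x) \<le> B" if "norm (x - ?p) = 1/2" for x
    using bd[of x] that by (auto simp: dist_norm norm_minus_commute)
  ultimately have "norm (2 * pi * \<i> * residue f ?p) \<le> B * (2 * pi * (1/2))"
    by (intro has_contour_integral_bound_circlepath[of f _ ?p]) auto
  then have "2 * pi * norm (residue f ?p) \<le> 2 * pi * (B / 2)"
    by (simp add: norm_mult)
  then show ?thesis
    by (subst (asm) mult_le_cancel_left_pos) auto
qed

text \<open>Along the ray \<open>norm \<omega>\<close> grows by at most 1 per step, so a function of
  exponential type \<open>A\<close> grows at most geometrically with ratio \<open>exp A\<close>,
  which the decay of a kernel can absorb.\<close>

lemma exp_growth_on_sphere:
  fixes \<beta> :: complex
  assumes A: "A \<ge> 0" and w: "\<omega> \<in> sphere (\<beta> + of_nat i) (1/2)"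
  shows "exp (A * norm \<omega>) \<le> exp (A * (norm \<beta> + 1/2)) * exp A ^ i"
proof -
  have "norm \<omega> \<le> norm (\<beta> + of_nat i) + 1/2"
    using w norm_triangle_ineq[of "\<beta> + of_nat i" "\<omega> - (\<beta> + of_nat i)"]
    by (simp add: dist_norm norm_minus_commute)
  also have "\<dots> \<le> norm \<beta> + real i + 1/2"
    using norm_triangle_ineq[of \<beta> "of_nat i"] by simp
  finally have "A * norm \<omega> \<le> A * (norm \<beta> + 1/2) + real i * A"
    using A mult_left_mono[of "norm \<omega>" "norm \<beta> + real i + 1/2" A] by (simp add: algebra_simps)
  then have "exp (A * norm \<omega>) \<le> exp (A * (norm \<beta> + 1/2) + real i * A)"
    by (simp only: exp_le_cancel_iff)
  then show ?thesis by (simp only: exp_add exp_of_nat_mult)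
qed

text \<open>All analytic facts about the residue series are read off from this bound: integrating a kernel
  against entire functions of a given exponential type is a bounded functional.\<close>

lemma rapid_kernel_bounded_functional:
  assumes H: "rapid_kernel \<beta> H" and A: "A \<ge> 0"
  shows "\<exists>K. \<forall>g C. g holomorphic_on UNIV \<longrightarrow> (\<forall>\<omega>. norm (g \<omega>) \<le> C * exp (A * norm \<omega>)) \<longrightarrow>
     summable (\<lambda>i. norm (residue (\<lambda>\<omega>. H \<omega> * g \<omega>) (\<beta> + of_nat i))) \<and>
     norm (residue_sum \<beta> (\<lambda>\<omega>. H \<omega> * g \<omega>)) \<le> K * C"
proof -
  \<comment> \<open>In the ratio \<open>2 * exp A\<close>, the factor \<open>exp A\<close> cancels
    the growth of \<open>g\<close> and the factor 2 leaves a geometric series in 1/2.\<close>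
  have "(2 * exp A :: real) \<ge> 1" using A one_le_exp_iff[of A] by linarith
  then obtain M where M: "\<And>i \<omega>. \<omega> \<in> sphere (\<beta> + of_nat i) (1/2) \<Longrightarrow> norm (H \<omega>) \<le> M / (2 * exp A) ^ i"
    using H unfolding rapid_kernel_def by blast
  define E where "E = exp (A * (norm \<beta> + 1/2))"
  show ?thesis
  proof (intro exI[of _ "M * E"] allI impI)
    fix g C assume g: "g holomorphic_on UNIV" and gb: "\<forall>\<omega>. norm (g \<omega>) \<le> C * exp (A * norm \<omega>)"
    have C: "C \<ge> 0" using order_trans[OF norm_ge_zero gb[rule_format, of 0]] by simp
    have hol: "(\<lambda>\<omega>. H \<omega> * g \<omega>) holomorphic_on - ray \<beta>"
      using H g unfolding rapid_kernel_def by (auto intro!: holomorphic_intros intro: holomorphic_on_subset)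
    have bd: "norm (residue (\<lambda>\<omega>. H \<omega> * g \<omega>) (\<beta> + of_nat i)) \<le> (M * E * C / 2) * (1/2) ^ i" for i
    proof -
      have "norm (H \<omega> * g \<omega>) \<le> M * E * C * (1/2) ^ i" if w: "\<omega> \<in> sphere (\<beta> + of_nat i) (1/2)" for \<omega>
      proof -
        have "exp (A * norm \<omega>) \<le> E * exp A ^ i"
          unfolding E_def by (rule exp_growth_on_sphere[OF A w])
        then have "norm (g \<omega>) \<le> C * (E * exp A ^ i)"
          using order_trans[OF gb[rule_format, of \<omega>] mult_left_mono[OF _ C]] by blast
        then have "norm (H \<omega>) * norm (g \<omega>) \<le> (M / (2 * exp A) ^ i) * (C * (E * exp A ^ i))"
          by (intro mult_mono M[OF w] order_trans[OF norm_ge_zero M[OF w]]) auto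
        also have "\<dots> = M * E * C * (1/2) ^ i"
          by (simp add: power_mult_distrib power_divide field_simps)
        finally show ?thesis by (simp add: norm_mult)
      qed
      from residue_le_of_sphere_bound[OF hol this] show ?thesis by simp
    qed
    have s: "(\<lambda>i. (M * E * C / 2) * (1/2) ^ i) sums ((M * E * C / 2) * 2)"
      by (rule sums_mult) (use geometric_sums[of "1/2 :: real"] in simp)
    have sm: "summable (\<lambda>i. norm (residue (\<lambda>\<omega>. H \<omega> * g \<omega>) (\<beta> + of_nat i)))"
      by (rule summable_comparison_test_ev[OF _ sums_summable[OF s]]) (use bd in auto)
    have "norm (residue_sum \<beta> (\<lambda>\<omega>. H \<omega> * g \<omega>)) \<le> (\<Sum>i. norm (residue (\<lambda>\<omega>. H \<omega> * g \<omega>) (\<beta> + of_nat i)))"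
      unfolding residue_sum_def by (rule summable_norm[OF sm])
    also have "\<dots> \<le> (\<Sum>i. (M * E * C / 2) * (1/2) ^ i)"
      by (rule suminf_le[OF bd sm sums_summable[OF s]])
    also have "\<dots> = M * E * C" using sums_unique[OF s] by simp
    finally show "summable (\<lambda>i. norm (residue (\<lambda>\<omega>. H \<omega> * g \<omega>) (\<beta> + of_nat i))) \<and>
       norm (residue_sum \<beta> (\<lambda>\<omega>. H \<omega> * g \<omega>)) \<le> M * E * C" using sm by auto
  qed
qed

section \<open>Multipliers of exponential type\<close>

lemma exp_type_holo: "exp_type g \<Longrightarrow> g holomorphic_on A"
  unfolding exp_type_def by (auto intro: holomorphic_on_subset)

lemma exp_typeI:
  assumes "g holomorphic_on UNIV" "A \<ge> 0" "\<And>\<omega>. norm (g \<omega>) \<le> C * exp (A * norm \<omega>)"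
  shows "exp_type g"
  using assms unfolding exp_type_def by blast

lemma exp_type_const [intro]: "exp_type (\<lambda>_. c)"
  by (rule exp_typeI[of _ 0 "norm c"]) auto

lemma exp_type_ident [intro]: "exp_type (\<lambda>\<omega>. \<omega>)"
proof (rule exp_typeI[of _ 1 1])
  fix \<omega> :: complex
  show "norm \<omega> \<le> 1 * exp (1 * norm \<omega>)" using exp_ge_add_one_self[of "norm \<omega>"] by (simp del: exp_ge_add_one_self)
qed auto

lemma exp_type_exp [intro]: "exp_type (\<lambda>\<omega>. exp (\<omega> * l))"
proof (rule exp_typeI[of _ "norm l" 1])
  fix \<omega> :: complex
  show "norm (exp (\<omega> * l)) \<le> 1 * exp (norm l * norm \<omega>)"
    using norm_exp[of "\<omega> * l"] by (simp add: norm_mult mult.commute)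
qed (auto intro!: holomorphic_intros)

lemma exp_type_mult [intro]:
  assumes "exp_type f" "exp_type g" shows "exp_type (\<lambda>\<omega>. f \<omega> * g \<omega>)"
proof -
  obtain C A D B where *: "A \<ge> 0" "B \<ge> 0" "\<And>\<omega>. norm (f \<omega>) \<le> C * exp (A * norm \<omega>)"
      "\<And>\<omega>. norm (g \<omega>) \<le> D * exp (B * norm \<omega>)"
    using assms unfolding exp_type_def by blast
  have "norm (f \<omega> * g \<omega>) \<le> (C * D) * exp ((A + B) * norm \<omega>)" for \<omega>
  proof -
    have "norm (f \<omega>) * norm (g \<omega>) \<le> (C * exp (A * norm \<omega>)) * (D * exp (B * norm \<omega>))"
      using * by (intro mult_mono) (auto intro: order_trans[OF norm_ge_zero])
    then show ?thesis by (simp add: norm_mult algebra_simps exp_add)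
  qed
  then show ?thesis using *(1,2) exp_type_holo[OF assms(1)] exp_type_holo[OF assms(2)]
    by (intro exp_typeI[of _ "A + B" "C * D"] holomorphic_intros) auto
qed

lemma exp_type_add [intro]:
  assumes "exp_type f" "exp_type g" shows "exp_type (\<lambda>\<omega>. f \<omega> + g \<omega>)"
proof -
  obtain C A D B where *: "A \<ge> 0" "B \<ge> 0" "\<And>\<omega>. norm (f \<omega>) \<le> C * exp (A * norm \<omega>)"
      "\<And>\<omega>. norm (g \<omega>) \<le> D * exp (B * norm \<omega>)"
    using assms unfolding exp_type_def by blast
  have CD: "C \<ge> 0" "D \<ge> 0"
    using order_trans[OF norm_ge_zero *(3)[of 0]] order_trans[OF norm_ge_zero *(4)[of 0]] by auto
  have "norm (f \<omega> + g \<omega>) \<le> (C + D) * exp ((A + B) * norm \<omega>)" for \<omega>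
  proof -
    have "norm (f \<omega> + g \<omega>) \<le> C * exp (A * norm \<omega>) + D * exp (B * norm \<omega>)"
      using *(3,4)[of \<omega>] norm_triangle_ineq[of "f \<omega>" "g \<omega>"] by linarith
    also have "\<dots> \<le> C * exp ((A + B) * norm \<omega>) + D * exp ((A + B) * norm \<omega>)"
      using CD * by (intro add_mono mult_left_mono) (auto simp: mult_right_mono)
    finally show ?thesis by (simp add: algebra_simps)
  qed
  then show ?thesis using *(1,2) exp_type_holo[OF assms(1)] exp_type_holo[OF assms(2)]
    by (intro exp_typeI[of _ "A + B" "C + D"] holomorphic_intros) auto
qed

lemma exp_type_diff [intro]: "exp_type f \<Longrightarrow> exp_type g \<Longrightarrow> exp_type (\<lambda>\<omega>. f \<omega> - g \<omega>)"
  using exp_type_add[of f "\<lambda>\<omega>. (-1) * g \<omega>"] exp_type_mult[of "\<lambda>_. -1" g] exp_type_const by force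

lemma exp_type_sum [intro]: "(\<And>x. x \<in> X \<Longrightarrow> exp_type (f x)) \<Longrightarrow> exp_type (\<lambda>\<omega>. \<Sum>x\<in>X. f x \<omega>)"
  by (induction X rule: infinite_finite_induct) auto

lemma exp_type_prod [intro]: "(\<And>x. x \<in> X \<Longrightarrow> exp_type (f x)) \<Longrightarrow> exp_type (\<lambda>\<omega>. \<Prod>x\<in>X. f x \<omega>)"
  by (induction X rule: infinite_finite_induct) auto

lemma exp_type_power [intro]: "exp_type f \<Longrightarrow> exp_type (\<lambda>\<omega>. f \<omega> ^ n)"
  by (induction n) auto

lemma exp_type_prod_list [intro]: "(\<And>x. x \<in> set xs \<Longrightarrow> exp_type (f x)) \<Longrightarrow> exp_type (\<lambda>\<omega>. \<Prod>x\<leftarrow>xs. f x \<omega>)"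
  by (induction xs) auto

text \<open>If \<open>g\<close> has type \<open>A\<close>, the decay of \<open>H\<close> with ratio
  \<open>R * exp A\<close> gives the ratio \<open>R\<close> for the product.\<close>

lemma rapid_kernel_mult:
  assumes H: "rapid_kernel \<beta> H" and g: "exp_type g"
  shows "rapid_kernel \<beta> (\<lambda>\<omega>. H \<omega> * g \<omega>)"
  unfolding rapid_kernel_def
proof (intro conjI allI impI)
  show "(\<lambda>\<omega>. H \<omega> * g \<omega>) holomorphic_on - ray \<beta>"
    using H exp_type_holo[OF g] unfolding rapid_kernel_def by (auto intro!: holomorphic_intros)
  fix R :: real assume R: "R \<ge> 1"
  obtain C A where A: "A \<ge> 0" and gb: "\<And>\<omega>. norm (g \<omega>) \<le> C * exp (A * norm \<omega>)"
    using g unfolding exp_type_def by blast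
  have C: "C \<ge> 0" using order_trans[OF norm_ge_zero gb[of 0]] by simp
  have "R * exp A \<ge> 1" using mult_mono[OF R, of 1 "exp A"] A R by simp
  then obtain M where M: "\<And>i \<omega>. \<omega> \<in> sphere (\<beta> + of_nat i) (1/2) \<Longrightarrow> norm (H \<omega>) \<le> M / (R * exp A) ^ i"
    using H unfolding rapid_kernel_def by blast
  define E where "E = exp (A * (norm \<beta> + 1/2))"
  have "norm (H \<omega> * g \<omega>) \<le> M * (C * E) / R ^ i" if w: "\<omega> \<in> sphere (\<beta> + of_nat i) (1/2)" for \<omega> i
  proof -
    have "exp (A * norm \<omega>) \<le> E * exp A ^ i"
      unfolding E_def by (rule exp_growth_on_sphere[OF A w])
    then have "norm (g \<omega>) \<le> C * (E * exp A ^ i)"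
      using order_trans[OF gb[of \<omega>] mult_left_mono[OF _ C]] by blast
    then have "norm (H \<omega>) * norm (g \<omega>) \<le> (M / (R * exp A) ^ i) * (C * (E * exp A ^ i))"
      by (intro mult_mono M[OF w] order_trans[OF norm_ge_zero M[OF w]]) auto
    also have "\<dots> = M * (C * E) / R ^ i"
      using R by (simp add: power_mult_distrib power_divide field_simps)
    finally show ?thesis by (simp add: norm_mult)
  qed
  then show "\<exists>M. \<forall>i. \<forall>\<omega>\<in>sphere (\<beta> + of_nat i) (1/2). norm (H \<omega> * g \<omega>) \<le> M / R ^ i" by blast
qed

section \<open>Linearity of residue series\<close>

lemma rapid_kernel_summable:
  assumes "rapid_kernel \<beta> H"
  shows "summable (\<lambda>i. norm (residue H (\<beta> + of_nat i)))"
proof -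
  obtain K where K: "\<forall>g C. g holomorphic_on UNIV \<longrightarrow> (\<forall>\<omega>. norm (g \<omega>) \<le> C * exp (0 * norm \<omega>)) \<longrightarrow>
     summable (\<lambda>i. norm (residue (\<lambda>\<omega>. H \<omega> * g \<omega>) (\<beta> + of_nat i))) \<and>
     norm (residue_sum \<beta> (\<lambda>\<omega>. H \<omega> * g \<omega>)) \<le> K * C"
    using rapid_kernel_bounded_functional[OF assms order_refl] ..
  show ?thesis using K[rule_format, of "\<lambda>_. 1" 1] by simp
qed

lemma rapid_kernel_residue_sums:
  assumes "rapid_kernel \<beta> H"
  shows "(\<lambda>i. residue H (\<beta> + of_nat i)) sums residue_sum \<beta> H"
  unfolding residue_sum_def using summable_norm_cancel[OF rapid_kernel_summable[OF assms]]
  by (rule summable_sums)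

lemma rapid_kernel_residue_add:
  assumes "rapid_kernel \<beta> F" "rapid_kernel \<beta> G"
  shows "residue (\<lambda>\<omega>. F \<omega> + G \<omega>) (\<beta> + of_nat i) = residue F (\<beta> + of_nat i) + residue G (\<beta> + of_nat i)"
  by (rule residue_add[of "ball (\<beta> + of_nat i) 1"])
     (use assms ray_minus_singleton[of \<beta> i] in \<open>auto simp: rapid_kernel_def intro: holomorphic_on_subset\<close>)

lemma rapid_kernel_residue_lmul:
  assumes "rapid_kernel \<beta> F"
  shows "residue (\<lambda>\<omega>. c * F \<omega>) (\<beta> + of_nat i) = c * residue F (\<beta> + of_nat i)"
  by (rule residue_lmul[of "ball (\<beta> + of_nat i) 1"])
     (use assms ray_minus_singleton[of \<beta> i] in \<open>auto simp: rapid_kernel_def intro: holomorphic_on_subset\<close>)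

lemma residue_sum_add:
  assumes "rapid_kernel \<beta> F" "rapid_kernel \<beta> G"
  shows "residue_sum \<beta> (\<lambda>\<omega>. F \<omega> + G \<omega>) = residue_sum \<beta> F + residue_sum \<beta> G"
  using sums_add[OF assms[THEN rapid_kernel_residue_sums]]
  by (simp add: rapid_kernel_residue_add[OF assms, symmetric] residue_sum_def sums_iff)

lemma residue_sum_cmult:
  assumes "rapid_kernel \<beta> F"
  shows "residue_sum \<beta> (\<lambda>\<omega>. c * F \<omega>) = c * residue_sum \<beta> F"
  using sums_mult[OF assms[THEN rapid_kernel_residue_sums], of c]
  by (simp add: rapid_kernel_residue_lmul[OF assms, symmetric] residue_sum_def sums_iff)

lemma residue_sum_diff:
  assumes "rapid_kernel \<beta> F" "rapid_kernel \<beta> G"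
  shows "residue_sum \<beta> (\<lambda>\<omega>. F \<omega> - G \<omega>) = residue_sum \<beta> F - residue_sum \<beta> G"
  using residue_sum_add[OF assms(1), of "\<lambda>\<omega>. (-1) * G \<omega>"] residue_sum_cmult[OF assms(2), of "-1"]
    rapid_kernel_mult[OF assms(2) exp_type_const[of "-1"]] by simp

text \<open>Meant for a polynomial in the shift by 2\<pi>i, which acts on
  \<open>exp (\<omega> * l)\<close> as a finite combination of exponentials.\<close>

lemma residue_sum_finite_sum:
  assumes "rapid_kernel \<beta> H" "finite X" "\<And>x. x \<in> X \<Longrightarrow> exp_type (g x)"
  shows "residue_sum \<beta> (\<lambda>\<omega>. H \<omega> * (\<Sum>x\<in>X. c x * g x \<omega>)) = (\<Sum>x\<in>X. c x * residue_sum \<beta> (\<lambda>\<omega>. H \<omega> * g x \<omega>))"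
  using assms(2,3)
proof (induction X rule: finite_induct)
  case empty
  then show ?case by (simp add: residue_sum_def residue_const)
next
  case (insert x X)
  have 1: "rapid_kernel \<beta> (\<lambda>\<omega>. H \<omega> * g x \<omega>)" using assms(1) insert.prems by (intro rapid_kernel_mult) auto
  have 2: "rapid_kernel \<beta> (\<lambda>\<omega>. H \<omega> * (\<Sum>x\<in>X. c x * g x \<omega>))"
    using assms(1) insert.prems by (intro rapid_kernel_mult) (auto intro!: exp_type_sum exp_type_mult)
  have 3: "rapid_kernel \<beta> (\<lambda>\<omega>. c x * (H \<omega> * g x \<omega>))"
    using rapid_kernel_mult[OF 1 exp_type_const[of "c x"]] by (simp add: mult_ac)
  have "residue_sum \<beta> (\<lambda>\<omega>. H \<omega> * (\<Sum>x\<in>insert x X. c x * g x \<omega>)) =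
      residue_sum \<beta> (\<lambda>\<omega>. c x * (H \<omega> * g x \<omega>) + H \<omega> * (\<Sum>x\<in>X. c x * g x \<omega>))"
    using insert.hyps by (simp add: algebra_simps)
  then show ?case
    using insert by (simp add: residue_sum_add[OF 3 2] residue_sum_cmult[OF 1])
qed

section \<open>Differentiation in the logarithmic variable\<close>

text \<open>The second-order Taylor remainder in the form that the bounded functional accepts. The 2
  in the type \<open>norm l + 2\<close> collects one \<open>exp (norm w)\<close> from the remainder
  of the exponential series and one from
  \<open>(norm w)\<^sup>2 \<le> 2 * exp (norm w)\<close>.\<close>

lemma norm_exp_minus_linear_le:
  fixes w h l :: complex
  assumes "norm h \<le> 1"
  shows "norm (exp (w * (l + h)) - exp (w * l) - h * (w * exp (w * l))) \<le> 2 * (norm h)\<^sup>2 * exp ((norm l + 2) * norm w)"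
proof -
  have "norm (exp (w * h) - (1 + w * h)) \<le> exp \<bar>Re (w * h)\<bar> * norm (w * h) ^ 2"
    using Taylor_exp[of "w * h" 1] by (simp add: numeral_2_eq_2)
  also have "\<dots> \<le> exp (norm w) * (norm (w * h) ^ 2)"
    using abs_Re_le_cmod[of "w * h"] assms mult_left_mono[of "norm h" 1 "norm w"]
    by (intro mult_right_mono) (auto simp: norm_mult)
  also have "\<dots> = exp (norm w) * ((norm w)\<^sup>2 * (norm h)\<^sup>2)"
    by (simp add: norm_mult power_mult_distrib)
  also have "\<dots> \<le> exp (norm w) * ((2 * exp (norm w)) * (norm h)\<^sup>2)"
    using exp_lower_Taylor_quadratic[of "norm w"]
    by (intro mult_left_mono mult_right_mono) (auto simp: field_simps intro: order_trans[rotated])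
  finally have *: "norm (exp (w * h) - (1 + w * h)) \<le> exp (norm w) * ((2 * exp (norm w)) * (norm h)\<^sup>2)" .
  have e: "exp (w * (l + h)) - exp (w * l) - h * (w * exp (w * l)) = exp (w * l) * (exp (w * h) - (1 + w * h))"
    by (simp add: algebra_simps exp_add)
  have "norm (exp (w * l)) \<le> exp (norm l * norm w)"
    using norm_exp[of "w * l"] by (simp add: norm_mult mult.commute)
  then have "norm (exp (w * (l + h)) - exp (w * l) - h * (w * exp (w * l)))
     \<le> exp (norm l * norm w) * (exp (norm w) * ((2 * exp (norm w)) * (norm h)\<^sup>2))"
    unfolding e norm_mult by (intro mult_mono *) auto
  also have "\<dots> = 2 * (norm h)\<^sup>2 * exp ((norm l + 2) * norm w)"
  proof -
    have "(norm l + 2) * norm w = norm l * norm w + (norm w + norm w)" by (simp add: algebra_simps)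
    then show ?thesis by (simp only: exp_add) (simp only: mult_ac)
  qed
  finally show ?thesis .
qed

text \<open>The bounded functional is applied to the Taylor remainder of
  \<open>exp (\<omega> * l)\<close>, which is quadratic in \<open>h\<close>; after division by
  \<open>h\<close> the error is at most a multiple of \<open>norm h\<close>. No termwise interchange
  of limits is involved.\<close>

lemma residue_sum_exp_has_derivative:
  assumes H: "rapid_kernel \<beta> H"
  shows "((\<lambda>l. residue_sum \<beta> (\<lambda>\<omega>. H \<omega> * exp (\<omega> * l))) has_field_derivative
          residue_sum \<beta> (\<lambda>\<omega>. H \<omega> * (\<omega> * exp (\<omega> * l)))) (at l)"
proof -
  let ?F = "\<lambda>l. residue_sum \<beta> (\<lambda>\<omega>. H \<omega> * exp (\<omega> * l))"
  let ?D = "residue_sum \<beta> (\<lambda>\<omega>. H \<omega> * (\<omega> * exp (\<omega> * l)))"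
  have "norm l + 2 \<ge> 0" by (simp add: add_nonneg_nonneg)
  from rapid_kernel_bounded_functional[OF H this]
  obtain K where K: "\<forall>g C. g holomorphic_on UNIV \<longrightarrow> (\<forall>\<omega>. norm (g \<omega>) \<le> C * exp ((norm l + 2) * norm \<omega>)) \<longrightarrow>
     summable (\<lambda>i. norm (residue (\<lambda>\<omega>. H \<omega> * g \<omega>) (\<beta> + of_nat i))) \<and>
     norm (residue_sum \<beta> (\<lambda>\<omega>. H \<omega> * g \<omega>)) \<le> K * C" ..
  have bd: "norm ((?F (l + h) - ?F l) / h - ?D) \<le> 2 * K * norm h" if h: "norm h \<le> 1" "h \<noteq> 0" for h
  proof -
    define g where "g = (\<lambda>\<omega>. exp (\<omega> * (l + h)) - exp (\<omega> * l) - h * (\<omega> * exp (\<omega> * l)))"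
    have g: "norm (g \<omega>) \<le> (2 * (norm h)\<^sup>2) * exp ((norm l + 2) * norm \<omega>)" for \<omega>
      unfolding g_def using norm_exp_minus_linear_le[OF h(1)] by (simp add: mult_ac)
    have 1: "exp_type (\<lambda>\<omega>. exp (\<omega> * m))" "exp_type (\<lambda>\<omega>. \<omega> * exp (\<omega> * l))" for m by auto
    have k: "rapid_kernel \<beta> (\<lambda>\<omega>. H \<omega> * exp (\<omega> * m))" "rapid_kernel \<beta> (\<lambda>\<omega>. H \<omega> * (\<omega> * exp (\<omega> * l)))"
        "rapid_kernel \<beta> (\<lambda>\<omega>. H \<omega> * exp (\<omega> * m) - H \<omega> * exp (\<omega> * m'))"
        "rapid_kernel \<beta> (\<lambda>\<omega>. h * (H \<omega> * (\<omega> * exp (\<omega> * l))))" for m m'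
      using rapid_kernel_mult[OF H 1(1)[of m]] rapid_kernel_mult[OF H 1(2)]
        rapid_kernel_mult[OF H exp_type_diff[OF 1(1)[of m] 1(1)[of m']]]
        rapid_kernel_mult[OF H exp_type_mult[OF exp_type_const[of h] 1(2)]]
      by (simp_all add: right_diff_distrib mult.left_commute[of _ h])
    have "residue_sum \<beta> (\<lambda>\<omega>. H \<omega> * g \<omega>) = ?F (l + h) - ?F l - h * ?D"
      by (simp add: g_def right_diff_distrib residue_sum_diff k mult.left_commute[of _ h]
        residue_sum_cmult)
    moreover have "g holomorphic_on UNIV" unfolding g_def by (intro holomorphic_intros)
    ultimately have "norm (?F (l + h) - ?F l - h * ?D) \<le> K * (2 * (norm h)\<^sup>2)"
      using K[rule_format, of g "2 * (norm h)\<^sup>2"] g by simp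
    then have "norm ((?F (l + h) - ?F l - h * ?D) / h) \<le> K * (2 * (norm h)\<^sup>2) / norm h"
      by (simp add: norm_divide divide_right_mono)
    moreover have "(?F (l + h) - ?F l - h * ?D) / h = (?F (l + h) - ?F l) / h - ?D"
      using h by (simp add: field_simps)
    ultimately show ?thesis using h by (simp add: power2_eq_square mult_ac)
  qed
  have "((\<lambda>h. (?F (l + h) - ?F l) / h - ?D) \<longlongrightarrow> 0) (at 0)"
  proof (rule Lim_null_comparison)
    show "\<forall>\<^sub>F h in at 0. norm ((?F (l + h) - ?F l) / h - ?D) \<le> 2 * K * norm h"
      using bd by (auto simp: eventually_at intro!: exI[of _ 1])
    show "((\<lambda>h::complex. 2 * K * norm h) \<longlongrightarrow> 0) (at 0)"
      by (auto intro!: tendsto_eq_intros)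
  qed
  then show ?thesis unfolding DERIV_def by (rule LIM_zero_cancel)
qed

section \<open>Quotients of Gamma functions: functional equation and decay\<close>

text \<open>\<open>I\<close> indexes the first group of parameters, \<open>J\<close> all of them.
  With the denominators expressed by the entire function \<open>rGamma\<close>, singularities can
  only come from the factors indexed by \<open>I\<close>.\<close>

definition gamma_quot :: "(nat \<Rightarrow> complex) \<Rightarrow> nat set \<Rightarrow> nat set \<Rightarrow> complex \<Rightarrow> complex" where
  "gamma_quot b I J \<omega> = (\<Prod>j\<in>I. Gamma (b j - \<omega>)) * (\<Prod>j\<in>J - I. rGamma (1 - b j + \<omega>))"

lemma not_nonpos_Int_of_not_ray:
  assumes "c - \<beta> \<in> \<nat>" "\<omega> \<notin> ray \<beta>"
  shows "c - \<omega> \<notin> \<int>\<^sub>\<le>\<^sub>0"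
proof
  assume "c - \<omega> \<in> \<int>\<^sub>\<le>\<^sub>0"
  then obtain m where m: "c - \<omega> = - of_nat m" by (elim nonpos_Ints_cases')
  obtain k where k: "c - \<beta> = of_nat k" using assms(1) by (elim Nats_cases)
  have "\<omega> = \<beta> + of_nat (k + m)" using m k by (simp add: algebra_simps)
  then show False using assms(2) unfolding ray_def by blast
qed

text \<open>The recurrence of \<open>Gamma\<close> produces \<open>b j - \<omega>\<close> where the
  linear factor is \<open>\<omega> - b j\<close>, hence one sign per element of \<open>I\<close>;
  the reciprocal factors give none. The argument \<open>(-1) ^ k * \<zeta>\<close> of the solutions
  compensates this sign.\<close>

lemma gamma_quot_functional_equation:
  assumes "finite J" "I \<subseteq> J" "\<And>j. j \<in> I \<Longrightarrow> b j - \<beta> \<in> \<nat>" "\<omega> \<notin> ray \<beta>"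
  shows "gamma_quot b I J \<omega> * (\<Prod>j\<in>J. \<omega> - b j) = (-1) ^ card I * gamma_quot b I J (\<omega> - 1)"
proof -
  \<comment> \<open>This recurrence needs \<open>b j - \<omega>\<close> off the nonpositive
    integers, that is, \<omega> off the ray; the one for \<open>rGamma\<close> holds
    everywhere.\<close>
  have I: "Gamma (b j - \<omega>) * (\<omega> - b j) = (-1) * Gamma (b j - (\<omega> - 1))" if "j \<in> I" for j
    using Gamma_plus1[OF not_nonpos_Int_of_not_ray[OF assms(3)[OF that] assms(4)]]
    by (simp add: algebra_simps)
  have JI: "rGamma (1 - b j + \<omega>) * (\<omega> - b j) = rGamma (1 - b j + (\<omega> - 1))" for j
    using rGamma_plus1[of "\<omega> - b j"] by (simp add: algebra_simps)
  have "gamma_quot b I J \<omega> * (\<Prod>j\<in>J. \<omega> - b j) =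
     (\<Prod>j\<in>I. Gamma (b j - \<omega>) * (\<omega> - b j)) * (\<Prod>j\<in>J - I. rGamma (1 - b j + \<omega>) * (\<omega> - b j))"
    unfolding gamma_quot_def prod.distrib using prod.subset_diff[OF assms(2,1), of "\<lambda>j. \<omega> - b j"]
    by (simp add: mult_ac)
  also have "(\<Prod>j\<in>I. Gamma (b j - \<omega>) * (\<omega> - b j)) = (\<Prod>j\<in>I. (-1) * Gamma (b j - (\<omega> - 1)))"
    by (rule prod.cong[OF refl I])
  also have "\<dots> = (-1) ^ card I * (\<Prod>j\<in>I. Gamma (b j - (\<omega> - 1)))"
    by (subst prod.distrib) simp
  finally show ?thesis by (simp add: JI gamma_quot_def)
qed

lemma gamma_quot_holomorphic:
  assumes "\<And>j. j \<in> I \<Longrightarrow> b j - \<beta> \<in> \<nat>"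
  shows "gamma_quot b I J holomorphic_on - ray \<beta>"
  unfolding gamma_quot_def[abs_def]
  using not_nonpos_Int_of_not_ray[OF assms] by (intro holomorphic_intros) auto

text \<open>The functional equation divides by a product of linear factors at each step along the ray,
  whence decay faster than any geometric sequence.\<close>

lemma gamma_quot_rapid_kernel:
  assumes J: "finite J" "J \<noteq> {}" and I: "I \<subseteq> J" "\<And>j. j \<in> I \<Longrightarrow> b j - \<beta> \<in> \<nat>"
  shows "rapid_kernel \<beta> (gamma_quot b I J)"
  unfolding rapid_kernel_def
proof (intro conjI allI impI)
  let ?H = "gamma_quot b I J"
  show hol: "?H holomorphic_on - ray \<beta>" by (rule gamma_quot_holomorphic[OF I(2)])
  fix R :: real assume R: "R \<ge> 1"
  define S where "S = (\<Sum>j\<in>J. norm (\<beta> - b j))"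
  \<comment> \<open>From index \<open>N\<close> on, each factor \<open>\<omega> + 1 - b j\<close>
    has modulus at least \<open>Suc i - 1/2 - S\<close>, which exceeds \<open>R\<close>.\<close>
  obtain N :: nat where N: "real N \<ge> S + R + 1" using real_arch_simple by blast
  have step: "norm (?H (\<omega> + 1)) \<le> norm (?H \<omega>) / R" if i: "i \<ge> N" and w: "\<omega> \<in> sphere (\<beta> + of_nat i) (1/2)" for i \<omega>
  proof -
    have w1: "\<omega> + 1 \<in> sphere (\<beta> + of_nat (Suc i)) (1/2)"
      using w by (simp add: dist_norm algebra_simps)
    have "norm (\<omega> + 1 - b j) \<ge> R" if "j \<in> J" for j
    proof -
      have "norm (\<beta> - b j) \<le> S" unfolding S_def using J that by (intro member_le_sum) auto
      moreover have "of_nat (Suc i) = (\<omega> + 1 - b j) + ((\<beta> + of_nat (Suc i)) - (\<omega> + 1)) - (\<beta> - b j)" by simp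
      then have "norm (of_nat (Suc i) :: complex) \<le> norm ((\<omega> + 1 - b j) + ((\<beta> + of_nat (Suc i)) - (\<omega> + 1))) + norm (\<beta> - b j)"
        using norm_triangle_ineq4 by metis
      then have "real (Suc i) \<le> norm (\<omega> + 1 - b j) + norm ((\<beta> + of_nat (Suc i)) - (\<omega> + 1)) + norm (\<beta> - b j)"
        using norm_triangle_ineq[of "\<omega> + 1 - b j" "(\<beta> + of_nat (Suc i)) - (\<omega> + 1)"]
        by (simp only: norm_of_nat)
      moreover have "norm ((\<beta> + of_nat (Suc i)) - (\<omega> + 1)) = 1/2" using w1 by (simp only: mem_sphere dist_norm)
      ultimately show ?thesis using N i by simp
    qed
    then have "(\<Prod>j\<in>J. R) \<le> (\<Prod>j\<in>J. norm (\<omega> + 1 - b j))"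
      using R by (intro prod_mono) auto
    moreover have "R \<le> R ^ card J"
      using R J self_le_power[of R "card J"] by (simp add: card_gt_0_iff)
    ultimately have P: "R \<le> norm (\<Prod>j\<in>J. \<omega> + 1 - b j)"
      by (simp add: prod_norm)
    have "norm (?H (\<omega> + 1) * (\<Prod>j\<in>J. \<omega> + 1 - b j)) = norm (?H \<omega>)"
      using gamma_quot_functional_equation[OF J(1) I, where \<omega> = "\<omega> + 1"] subsetD[OF sphere_subset_ray_compl w1]
      by (simp add: norm_mult norm_power)
    then have "norm (?H (\<omega> + 1)) * R \<le> norm (?H \<omega>)"
      using mult_left_mono[OF P, of "norm (?H (\<omega> + 1))"] by (simp add: norm_mult)
    then show ?thesis using R by (simp add: field_simps)
  qed
  \<comment> \<open>The recursion gains a factor only from \<open>N\<close> on; the first circles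
    are handled by compactness.\<close>
  have "compact (\<Union>i\<in>{..N}. sphere (\<beta> + of_nat i) (1/2))" by (intro compact_UN) auto
  moreover have "continuous_on (\<Union>i\<in>{..N}. sphere (\<beta> + of_nat i) (1/2)) ?H"
    by (rule continuous_on_subset[OF holomorphic_on_imp_continuous_on[OF hol]])
       (use sphere_subset_ray_compl in blast)
  ultimately have "bounded (?H ` (\<Union>i\<in>{..N}. sphere (\<beta> + of_nat i) (1/2)))"
    by (intro compact_imp_bounded compact_continuous_image)
  then obtain B where B: "B > 0" "\<And>i \<omega>. i \<le> N \<Longrightarrow> \<omega> \<in> sphere (\<beta> + of_nat i) (1/2) \<Longrightarrow> norm (?H \<omega>) \<le> B"
    unfolding bounded_pos by force
  \<comment> \<open>The factor \<open>R ^ N\<close> keeps the bound above \<open>B\<close> for all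
    \<open>i \<le> N\<close>; afterwards each step gains \<open>1 / R\<close>.\<close>
  have "norm (?H \<omega>) \<le> B * R ^ N / R ^ i" if "\<omega> \<in> sphere (\<beta> + of_nat i) (1/2)" for i \<omega>
    using that
  proof (induction i arbitrary: \<omega>)
    case 0
    have "B * 1 \<le> B * R ^ N" using B(1) R by (intro mult_left_mono) auto
    then show ?case using B(2)[of 0 \<omega>] 0 by simp
  next
    case (Suc i)
    show ?case
    proof (cases "Suc i \<le> N")
      case True
      have "R ^ Suc i \<le> R ^ N" using R True by (intro power_increasing) auto
      then have "B * 1 \<le> B * (R ^ N / R ^ Suc i)" using B(1) R by (intro mult_left_mono) auto
      then show ?thesis using B(2)[OF True Suc.prems] by simp
    next
      case False
      have w: "\<omega> - 1 \<in> sphere (\<beta> + of_nat i) (1/2)"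
        using Suc.prems by (simp add: dist_norm algebra_simps)
      have "norm (?H (\<omega> - 1 + 1)) \<le> norm (?H (\<omega> - 1)) / R" using False by (intro step[OF _ w]) auto
      also have "\<dots> \<le> (B * R ^ N / R ^ i) / R" using R by (intro divide_right_mono Suc.IH[OF w]) auto
      finally show ?thesis using R by (simp add: field_simps)
    qed
  qed
  then show "\<exists>M. \<forall>i. \<forall>\<omega>\<in>sphere (\<beta> + of_nat i) (1/2). norm (?H \<omega>) \<le> M / R ^ i" by blast
qed

section \<open>The differential equation\<close>

lemma residue_shift: "residue (\<lambda>\<omega>. f (\<omega> - a)) p = residue f (p - a)"
  by (subst (1 2) residue_shift_0) (simp add: algebra_simps)

lemma open_ray_compl: "open (- ray \<beta>)"
proof -
  have "ray \<beta> = (\<lambda>x. \<beta> + x) ` \<nat>" by (auto simp: ray_def Nats_def)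
  moreover have "closed ((\<lambda>x. \<beta> + x) ` (\<nat> :: complex set))"
    by (intro closed_translation closed_Nats)
  ultimately show ?thesis by (simp add: open_closed)
qed

text \<open>Multiplication by the linear factors translates the kernel by 1, hence moves the
  residues by one place along the ray; \<open>exp l\<close> comes from writing
  \<open>\<omega> = (\<omega> - 1) + 1\<close> in the exponential. The one extra term, at
  \<open>\<beta> - 1\<close>, vanishes because the translated point is off the ray.\<close>

lemma residue_sum_functional_equation:
  assumes J: "finite J" "J \<noteq> {}" and I: "I \<subseteq> J" "\<And>j. j \<in> I \<Longrightarrow> b j - \<beta> \<in> \<nat>"
  shows "residue_sum \<beta> (\<lambda>\<omega>. gamma_quot b I J \<omega> * ((\<Prod>j\<in>J. \<omega> - b j) * exp (\<omega> * l))) =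
         (-1) ^ card I * exp l * residue_sum \<beta> (\<lambda>\<omega>. gamma_quot b I J \<omega> * exp (\<omega> * l))"
proof -
  let ?H = "gamma_quot b I J"
  define G where "G = (\<lambda>\<omega>. ?H \<omega> * exp (\<omega> * l))"
  define c where "c = (-1) ^ card I * exp l"
  note kern = gamma_quot_rapid_kernel[OF J I]
  have kG: "rapid_kernel \<beta> G" unfolding G_def by (intro rapid_kernel_mult kern exp_type_exp)
  have kp: "rapid_kernel \<beta> (\<lambda>\<omega>. ?H \<omega> * ((\<Prod>j\<in>J. \<omega> - b j) * exp (\<omega> * l)))"
    by (intro rapid_kernel_mult kern exp_type_mult exp_type_exp exp_type_prod exp_type_diff
        exp_type_ident exp_type_const)
  have hG: "G holomorphic_on - ray \<beta>" using kG by (simp add: rapid_kernel_def)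
  have ray: "\<beta> - 1 \<notin> ray \<beta>"
  proof
    assume "\<beta> - 1 \<in> ray \<beta>"
    then obtain i where "\<beta> - 1 = \<beta> + of_nat i" by (auto simp: ray_def)
    then have "of_nat (Suc i) = (0::complex)" by (simp add: algebra_simps)
    then show False by (simp only: of_nat_eq_0_iff)
  qed
  have punct: "ball (\<beta> + of_nat i) 1 - {\<beta> + of_nat i} \<subseteq> - ray \<beta>" for i by (rule ray_minus_singleton)
  \<comment> \<open>The functional equation is available only off the ray, but agreement on a
    punctured disc determines the residue.\<close>
  have res: "residue (\<lambda>\<omega>. ?H \<omega> * ((\<Prod>j\<in>J. \<omega> - b j) * exp (\<omega> * l))) (\<beta> + of_nat i) = residue (\<lambda>\<omega>. c * G \<omega>) (\<beta> + of_nat i - 1)" for i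
  proof -
    have "\<forall>\<^sub>F \<omega> in at (\<beta> + of_nat i). \<omega> \<in> ball (\<beta> + of_nat i) 1 - {\<beta> + of_nat i}"
      by (intro eventually_at_in_open) auto
    then have "\<forall>\<^sub>F \<omega> in at (\<beta> + of_nat i). ?H \<omega> * ((\<Prod>j\<in>J. \<omega> - b j) * exp (\<omega> * l)) = c * G (\<omega> - 1)"
    proof eventually_elim
      case (elim \<omega>)
      then have "\<omega> \<notin> ray \<beta>" using punct[of i] by blast
      then have "?H \<omega> * (\<Prod>j\<in>J. \<omega> - b j) = (-1) ^ card I * ?H (\<omega> - 1)"
        by (intro gamma_quot_functional_equation[OF J(1) I])
      moreover have "exp (\<omega> * l) = exp l * exp ((\<omega> - 1) * l)" by (simp add: algebra_simps flip: exp_add)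
      ultimately show ?case by (simp add: G_def c_def mult.assoc[symmetric])
    qed
    then have "residue (\<lambda>\<omega>. ?H \<omega> * ((\<Prod>j\<in>J. \<omega> - b j) * exp (\<omega> * l))) (\<beta> + of_nat i) = residue (\<lambda>\<omega>. c * G (\<omega> - 1)) (\<beta> + of_nat i)"
      by (intro residue_cong) auto
    then show ?thesis using residue_shift[of "\<lambda>\<omega>. c * G \<omega>" 1] by simp
  qed
  have r0: "residue (\<lambda>\<omega>. c * G \<omega>) (\<beta> - 1) = 0"
    using ray by (intro residue_holo[OF open_ray_compl]) (auto intro!: holomorphic_intros hG)
  have "(\<lambda>i. residue (\<lambda>\<omega>. ?H \<omega> * ((\<Prod>j\<in>J. \<omega> - b j) * exp (\<omega> * l))) (\<beta> + of_nat (Suc i))) = (\<lambda>i. c * residue G (\<beta> + of_nat i))"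
  proof
    fix i
    have "\<beta> + of_nat (Suc i) - 1 = \<beta> + of_nat i" by simp
    then show "residue (\<lambda>\<omega>. ?H \<omega> * ((\<Prod>j\<in>J. \<omega> - b j) * exp (\<omega> * l))) (\<beta> + of_nat (Suc i)) = c * residue G (\<beta> + of_nat i)"
      unfolding res using rapid_kernel_residue_lmul[OF kG] by metis
  qed
  moreover have "(\<lambda>i. residue (\<lambda>\<omega>. ?H \<omega> * ((\<Prod>j\<in>J. \<omega> - b j) * exp (\<omega> * l))) (\<beta> + of_nat (Suc i))) sums
     (residue_sum \<beta> (\<lambda>\<omega>. ?H \<omega> * ((\<Prod>j\<in>J. \<omega> - b j) * exp (\<omega> * l))) - residue (\<lambda>\<omega>. ?H \<omega> * ((\<Prod>j\<in>J. \<omega> - b j) * exp (\<omega> * l))) (\<beta> + of_nat 0))"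
    using rapid_kernel_residue_sums[OF kp] by (subst sums_Suc_iff) simp
  moreover have "residue (\<lambda>\<omega>. ?H \<omega> * ((\<Prod>j\<in>J. \<omega> - b j) * exp (\<omega> * l))) (\<beta> + of_nat 0) = 0"
    unfolding res using r0 by simp
  ultimately have "(\<lambda>i. c * residue G (\<beta> + of_nat i)) sums residue_sum \<beta> (\<lambda>\<omega>. ?H \<omega> * ((\<Prod>j\<in>J. \<omega> - b j) * exp (\<omega> * l)))"
    by simp
  from sums_unique2[OF this sums_mult[OF rapid_kernel_residue_sums[OF kG], of c]]
  show ?thesis by (simp add: c_def G_def)
qed

text \<open>As \<open>M\<close> has derivative \<open>1 / z\<close>, the chain rule turns
  \<open>z d/dz\<close> into \<open>d/dl\<close> at \<open>l = M z\<close>, so each Euler operator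
  multiplies the integrand by \<open>\<omega> - c\<close>. The induction runs over all of the open
  set \<open>D\<close>, since \<open>deriv\<close> needs the formula in a neighbourhood.\<close>

lemma euler_prod_residue_sum:
  assumes H: "rapid_kernel \<beta> H" and D: "open D"
    and M: "\<And>z. z \<in> D \<Longrightarrow> (M has_field_derivative inverse z) (at z)" and D0: "0 \<notin> D"
    and f: "\<And>z. z \<in> D \<Longrightarrow> f z = - residue_sum \<beta> (\<lambda>\<omega>. H \<omega> * exp (\<omega> * M z))"
    and z: "z \<in> D"
  shows "euler_prod bs f z = - residue_sum \<beta> (\<lambda>\<omega>. H \<omega> * ((\<Prod>c\<leftarrow>bs. \<omega> - c) * exp (\<omega> * M z)))"
  using z
proof (induction bs arbitrary: z)
  case Nil
  then show ?case by (simp add: euler_prod_def f)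
next
  case (Cons c bs)
  define F where "F = (\<lambda>\<omega>. H \<omega> * (\<Prod>c\<leftarrow>bs. \<omega> - c))"
  have kF: "rapid_kernel \<beta> F"
    unfolding F_def by (intro rapid_kernel_mult H exp_type_prod_list exp_type_diff exp_type_ident exp_type_const)
  have eq: "euler_prod bs f z = - residue_sum \<beta> (\<lambda>\<omega>. F \<omega> * exp (\<omega> * M z))" if "z \<in> D" for z
    using Cons.IH[OF that] by (simp add: F_def mult.assoc)
  have z0: "z \<noteq> 0" using Cons.prems D0 by auto
  have "((\<lambda>z. - residue_sum \<beta> (\<lambda>\<omega>. F \<omega> * exp (\<omega> * M z))) has_field_derivative
      - (residue_sum \<beta> (\<lambda>\<omega>. F \<omega> * (\<omega> * exp (\<omega> * M z))) * inverse z)) (at z)"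
    by (intro DERIV_minus DERIV_chain2[OF residue_sum_exp_has_derivative[OF kF]] M[OF Cons.prems])
  then have "(euler_prod bs f has_field_derivative
      - (residue_sum \<beta> (\<lambda>\<omega>. F \<omega> * (\<omega> * exp (\<omega> * M z))) * inverse z)) (at z)"
    by (rule has_field_derivative_transform_within_open[OF _ D Cons.prems]) (simp add: eq)
  then have "deriv (euler_prod bs f) z = - (residue_sum \<beta> (\<lambda>\<omega>. F \<omega> * (\<omega> * exp (\<omega> * M z))) * inverse z)"
    by (rule DERIV_imp_deriv)
  then have "euler_prod (c # bs) f z =
      - (residue_sum \<beta> (\<lambda>\<omega>. F \<omega> * (\<omega> * exp (\<omega> * M z))) - c * residue_sum \<beta> (\<lambda>\<omega>. F \<omega> * exp (\<omega> * M z)))"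
    using z0 eq[OF Cons.prems] by (simp add: euler_prod_def euler_op_def)
  also have "residue_sum \<beta> (\<lambda>\<omega>. F \<omega> * (\<omega> * exp (\<omega> * M z))) - c * residue_sum \<beta> (\<lambda>\<omega>. F \<omega> * exp (\<omega> * M z)) =
      residue_sum \<beta> (\<lambda>\<omega>. F \<omega> * (\<omega> * exp (\<omega> * M z)) - c * (F \<omega> * exp (\<omega> * M z)))"
  proof -
    have 1: "rapid_kernel \<beta> (\<lambda>\<omega>. F \<omega> * exp (\<omega> * M z))" "rapid_kernel \<beta> (\<lambda>\<omega>. F \<omega> * (\<omega> * exp (\<omega> * M z)))"
      "rapid_kernel \<beta> (\<lambda>\<omega>. F \<omega> * exp (\<omega> * M z) * c)"
      by (intro rapid_kernel_mult kF exp_type_exp exp_type_mult exp_type_ident exp_type_const)+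
    then show ?thesis by (subst residue_sum_diff) (simp_all add: residue_sum_cmult mult_ac)
  qed
  also have "(\<lambda>\<omega>. F \<omega> * (\<omega> * exp (\<omega> * M z)) - c * (F \<omega> * exp (\<omega> * M z))) =
      (\<lambda>\<omega>. H \<omega> * ((\<Prod>c\<leftarrow>c # bs. \<omega> - c) * exp (\<omega> * M z)))"
    by (simp add: F_def fun_eq_iff algebra_simps)
  finally show ?case .
qed

section \<open>The G-function as a residue series along one ray\<close>

text \<open>Each progression of poles is contained in the one starting at \<beta>; coinciding poles
  of several factors raise the pole order, not the number of points.\<close>

lemma meijerG_poles_eq_ray:
  assumes "\<beta> \<in> set cs" "\<And>c. c \<in> set cs \<Longrightarrow> c - \<beta> \<in> \<nat>"
  shows "meijerG_poles cs = ray \<beta>"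
proof
  show "meijerG_poles cs \<subseteq> ray \<beta>"
  proof
    fix x assume "x \<in> meijerG_poles cs"
    then obtain c k where x: "x = c + of_nat k" "c \<in> set cs" by (auto simp: meijerG_poles_def)
    then obtain m where "c - \<beta> = of_nat m" using assms(2) by (meson Nats_cases)
    then have "x = \<beta> + of_nat (m + k)" using x by (simp add: algebra_simps)
    then show "x \<in> ray \<beta>" unfolding ray_def by blast
  qed
  show "ray \<beta> \<subseteq> meijerG_poles cs" using assms(1) by (auto simp: ray_def meijerG_poles_def)
qed

text \<open>Absolute convergence identifies the unordered sum with the series.\<close>

lemma infsum_residue_ray:
  assumes "rapid_kernel \<beta> H"
  shows "infsum (residue H) (ray \<beta>) = residue_sum \<beta> H"
proof -
  have "infsum (residue H) (ray \<beta>) = infsum (residue H \<circ> (\<lambda>i. \<beta> + of_nat i)) UNIV"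
    unfolding ray_def by (rule infsum_reindex) (simp add: inj_on_def)
  also have "\<dots> = residue_sum \<beta> H"
    using norm_summable_imp_has_sum[OF rapid_kernel_summable[OF assms] rapid_kernel_residue_sums[OF assms]]
    by (intro infsumI) (simp add: o_def)
  finally show ?thesis .
qed

section \<open>The shift by 2\<pi>i and pole orders\<close>

abbreviation cis_turn :: "complex \<Rightarrow> complex" where
  "cis_turn \<omega> \<equiv> exp (\<omega> * (2 * of_real pi * \<i>))"

text \<open>Hence a turn factor \<open>cis_turn \<omega> - cis_turn p\<close> vanishes on the whole
  class of \<open>p\<close> modulo the integers and nowhere else: it lowers pole orders along an
  entire ray and is nonzero on the other classes.\<close>

lemma cis_turn_eq_iff: "cis_turn x = cis_turn y \<longleftrightarrow> x - y \<in> \<int>"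
proof -
  have "cis_turn x = cis_turn y \<longleftrightarrow> (\<exists>n::int. x * (2 * of_real pi * \<i>) = y * (2 * of_real pi * \<i>) + of_real (of_int (2 * n) * pi) * \<i>)"
    by (simp add: exp_eq)
  also have "\<dots> \<longleftrightarrow> (\<exists>n::int. x - y = of_int n)"
  proof (rule ex_cong1)
    fix n :: int
    have "x * (2 * of_real pi * \<i>) = y * (2 * of_real pi * \<i>) + of_real (of_int (2 * n) * pi) * \<i> \<longleftrightarrow>
        (x - y) * (2 * of_real pi * \<i>) = of_int n * (2 * of_real pi * \<i>)"
      by (auto simp: algebra_simps)
    then show "x * (2 * of_real pi * \<i>) = y * (2 * of_real pi * \<i>) + of_real (of_int (2 * n) * pi) * \<i> \<longleftrightarrow> x - y = of_int n"
      by simp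
  qed
  finally show ?thesis by (auto simp: Ints_def)
qed

text \<open>The reflection \<open>\<omega> \<mapsto> c - \<omega>\<close> reverses the sign of the
  residue of \<open>Gamma\<close>.\<close>

lemma Gamma_reflected_residue_limit:
  fixes c p :: complex
  assumes n: "p - c = of_nat n"
  shows "((\<lambda>\<omega>. Gamma (c - \<omega>) * (\<omega> - p)) \<longlongrightarrow> - ((-1) ^ n / fact n)) (at p)"
proof -
  have "filterlim (\<lambda>\<omega>. c - \<omega>) (at (- of_nat n)) (at p)"
  proof (rule filterlim_atI)
    have "((\<lambda>\<omega>. c - \<omega>) \<longlongrightarrow> c - p) (at p)" by (intro tendsto_intros)
    moreover have "c - p = - of_nat n" using n by (simp add: algebra_simps)
    ultimately show "((\<lambda>\<omega>. c - \<omega>) \<longlongrightarrow> - of_nat n) (at p)" by simp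
    show "\<forall>\<^sub>F \<omega> in at p. c - \<omega> \<noteq> - of_nat n"
      using n by (auto simp: eventually_at_filter algebra_simps)
  qed
  from filterlim_compose[OF Gamma_residues this]
  have "((\<lambda>\<omega>. Gamma (c - \<omega>) * ((c - \<omega>) + of_nat n)) \<longlongrightarrow> (-1) ^ n / fact n) (at p)" by simp
  from tendsto_minus[OF this] show ?thesis by (simp add: n[symmetric] algebra_simps)
qed

text \<open>Poles and regular points are covered together (at a regular point the limit is 0), since
  the factors of one group begin to have poles at different points of the common ray.\<close>

lemma Gamma_simple_pole_limit:
  fixes c p :: complex
  shows "\<exists>a. ((\<lambda>\<omega>. Gamma (c - \<omega>) * (\<omega> - p)) \<longlongrightarrow> a) (at p) \<and> (p - c \<in> \<nat> \<longrightarrow> a \<noteq> 0)"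
proof (cases "p - c \<in> \<nat>")
  case True
  then obtain n where "p - c = of_nat n" by (elim Nats_cases)
  from Gamma_reflected_residue_limit[OF this] show ?thesis
    by (intro exI[of _ "- ((-1) ^ n / fact n)"]) auto
next
  case False
  have "c - p \<notin> \<int>\<^sub>\<le>\<^sub>0"
  proof
    assume "c - p \<in> \<int>\<^sub>\<le>\<^sub>0"
    then obtain m where "c - p = - of_nat m" by (elim nonpos_Ints_cases')
    then have "p - c = of_nat m" by (simp add: algebra_simps)
    then show False using False by simp
  qed
  then have "((\<lambda>\<omega>. Gamma (c - \<omega>) * (\<omega> - p)) \<longlongrightarrow> Gamma (c - p) * (p - p)) (at p)"
    by (intro tendsto_intros) auto
  then show ?thesis using False by blast
qed

text \<open>The zero of the turn factor at \<open>p\<close> is simple, with derivative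
  \<open>cis_turn p\<close> times 2\<pi>i, so it cancels exactly a simple pole.\<close>

lemma turn_mult_Gamma_limit:
  fixes c p :: complex
  shows "\<exists>a. ((\<lambda>\<omega>. (cis_turn \<omega> - cis_turn p) * Gamma (c - \<omega>)) \<longlongrightarrow> a) (at p) \<and> (p - c \<in> \<nat> \<longrightarrow> a \<noteq> 0)"
proof -
  obtain a where a: "((\<lambda>\<omega>. Gamma (c - \<omega>) * (\<omega> - p)) \<longlongrightarrow> a) (at p)" "p - c \<in> \<nat> \<longrightarrow> a \<noteq> 0"
    using Gamma_simple_pole_limit[of c p] by blast
  have "(cis_turn has_field_derivative cis_turn p * (2 * of_real pi * \<i>)) (at p)"
    by (auto intro!: derivative_eq_intros)
  then have "((\<lambda>\<omega>. (cis_turn \<omega> - cis_turn p) / (\<omega> - p)) \<longlongrightarrow> cis_turn p * (2 * of_real pi * \<i>)) (at p)"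
    unfolding has_field_derivative_iff by simp
  from tendsto_mult[OF this a(1)]
  have "((\<lambda>\<omega>. (cis_turn \<omega> - cis_turn p) / (\<omega> - p) * (Gamma (c - \<omega>) * (\<omega> - p))) \<longlongrightarrow> cis_turn p * (2 * of_real pi * \<i>) * a) (at p)" .
  then have "((\<lambda>\<omega>. (cis_turn \<omega> - cis_turn p) * Gamma (c - \<omega>)) \<longlongrightarrow> cis_turn p * (2 * of_real pi * \<i>) * a) (at p)"
    by (rule Lim_transform_eventually) (auto simp: eventually_at_filter)
  then show ?thesis using a(2) by (intro exI[of _ "cis_turn p * (2 * of_real pi * \<i>) * a"]) auto
qed

lemma turn_power_mult_Gammas_limit:
  assumes "finite I"
  shows "\<exists>a. ((\<lambda>\<omega>. (cis_turn \<omega> - cis_turn p) ^ card I * (\<Prod>j\<in>I. Gamma (b j - \<omega>))) \<longlongrightarrow> a) (at p) \<and>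
    ((\<forall>j\<in>I. p - b j \<in> \<nat>) \<longrightarrow> a \<noteq> 0)"
  using assms
proof (induction I rule: finite_induct)
  case empty
  then show ?case by (auto intro!: exI[of _ 1])
next
  case (insert j I)
  then obtain a where a: "((\<lambda>\<omega>. (cis_turn \<omega> - cis_turn p) ^ card I * (\<Prod>j\<in>I. Gamma (b j - \<omega>))) \<longlongrightarrow> a) (at p)"
      "(\<forall>j\<in>I. p - b j \<in> \<nat>) \<longrightarrow> a \<noteq> 0" by blast
  obtain a' where a': "((\<lambda>\<omega>. (cis_turn \<omega> - cis_turn p) * Gamma (b j - \<omega>)) \<longlongrightarrow> a') (at p)" "p - b j \<in> \<nat> \<longrightarrow> a' \<noteq> 0"
    using turn_mult_Gamma_limit by blast
  have "((\<lambda>\<omega>. (cis_turn \<omega> - cis_turn p) ^ card (insert j I) * (\<Prod>j\<in>insert j I. Gamma (b j - \<omega>))) \<longlongrightarrow> a' * a) (at p)"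
    using tendsto_mult[OF a'(1) a(1)] insert.hyps by (simp add: mult_ac)
  then show ?case using a(2) a'(2) by (intro exI[of _ "a' * a"]) auto
qed

text \<open>One Gamma factor takes the multiplier \<open>\<omega> - p\<close>, and each of the other
  \<open>card I - 1\<close> is paired with a turn factor. So \<open>m = card I - 1\<close> leaves at
  most a simple pole, and a genuine one where all Gamma factors have poles and nothing else
  vanishes; any further turn factor makes the limit 0.\<close>

lemma gamma_quot_turn_limit:
  assumes J: "finite J" "I \<subseteq> J" "I \<noteq> {}" and m: "m \<ge> card I - 1" and G: "isCont G p"
  shows "\<exists>a. ((\<lambda>\<omega>. gamma_quot b I J \<omega> * ((cis_turn \<omega> - cis_turn p) ^ m * G \<omega>) * (\<omega> - p)) \<longlongrightarrow> a) (at p) \<and>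
     (m \<ge> card I \<longrightarrow> a = 0) \<and>
     (m = card I - 1 \<longrightarrow> (\<forall>j\<in>I. p - b j \<in> \<nat>) \<longrightarrow> (\<forall>j\<in>J - I. 1 - b j + p \<notin> \<int>\<^sub>\<le>\<^sub>0) \<longrightarrow> G p \<noteq> 0 \<longrightarrow> a \<noteq> 0)"
proof -
  obtain j0 where j0: "j0 \<in> I" using J by auto
  define I' where "I' = I - {j0}"
  have fin: "finite I" using J finite_subset by auto
  have I: "I = insert j0 I'" "j0 \<notin> I'" "finite I'" using j0 fin by (auto simp: I'_def)
  have cI: "card I = Suc (card I')" using I by simp
  \<comment> \<open>\<open>d\<close> counts the surplus turn factors; at \<open>p\<close> they
    contribute \<open>0 ^ d\<close>, which is 1 for \<open>d = 0\<close> and 0 otherwise.\<close>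
  obtain d where d: "m = card I' + d" using m cI by (metis diff_Suc_1 le_Suc_ex)
  obtain a where a: "((\<lambda>\<omega>. (cis_turn \<omega> - cis_turn p) ^ card I' * (\<Prod>j\<in>I'. Gamma (b j - \<omega>))) \<longlongrightarrow> a) (at p)"
      "(\<forall>j\<in>I'. p - b j \<in> \<nat>) \<longrightarrow> a \<noteq> 0" using turn_power_mult_Gammas_limit[OF I(3)] by blast
  obtain a' where a': "((\<lambda>\<omega>. Gamma (b j0 - \<omega>) * (\<omega> - p)) \<longlongrightarrow> a') (at p)" "p - b j0 \<in> \<nat> \<longrightarrow> a' \<noteq> 0"
    using Gamma_simple_pole_limit by blast
  have r: "((\<lambda>\<omega>. \<Prod>j\<in>J - I. rGamma (1 - b j + \<omega>)) \<longlongrightarrow> (\<Prod>j\<in>J - I. rGamma (1 - b j + p))) (at p)"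
    by (intro isContD continuous_intros)
  have t: "((\<lambda>\<omega>. (cis_turn \<omega> - cis_turn p) ^ d) \<longlongrightarrow> (cis_turn p - cis_turn p) ^ d) (at p)"
    by (intro tendsto_intros)
  define A where "A = a' * a * (\<Prod>j\<in>J - I. rGamma (1 - b j + p)) * (cis_turn p - cis_turn p) ^ d * G p"
  have "((\<lambda>\<omega>. (Gamma (b j0 - \<omega>) * (\<omega> - p)) * ((cis_turn \<omega> - cis_turn p) ^ card I' * (\<Prod>j\<in>I'. Gamma (b j - \<omega>))) *
      (\<Prod>j\<in>J - I. rGamma (1 - b j + \<omega>)) * (cis_turn \<omega> - cis_turn p) ^ d * G \<omega>) \<longlongrightarrow> A) (at p)"
    unfolding A_def by (intro tendsto_mult a' a r t isContD[OF G])
  moreover have "(Gamma (b j0 - \<omega>) * (\<omega> - p)) * ((cis_turn \<omega> - cis_turn p) ^ card I' * (\<Prod>j\<in>I'. Gamma (b j - \<omega>))) *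
      (\<Prod>j\<in>J - I. rGamma (1 - b j + \<omega>)) * (cis_turn \<omega> - cis_turn p) ^ d * G \<omega>
      = gamma_quot b I J \<omega> * ((cis_turn \<omega> - cis_turn p) ^ m * G \<omega>) * (\<omega> - p)" for \<omega>
  proof -
    have "(\<Prod>j\<in>I. Gamma (b j - \<omega>)) = Gamma (b j0 - \<omega>) * (\<Prod>j\<in>I'. Gamma (b j - \<omega>))" using I by simp
    then show ?thesis unfolding gamma_quot_def d power_add by (simp only: mult_ac)
  qed
  ultimately have "((\<lambda>\<omega>. gamma_quot b I J \<omega> * ((cis_turn \<omega> - cis_turn p) ^ m * G \<omega>) * (\<omega> - p)) \<longlongrightarrow> A) (at p)"
    by simp
  moreover have "A = 0" if "m \<ge> card I" using that d cI by (simp add: A_def power_0_left)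
  moreover have "A \<noteq> 0" if "m = card I - 1" "\<forall>j\<in>I. p - b j \<in> \<nat>" "\<forall>j\<in>J - I. 1 - b j + p \<notin> \<int>\<^sub>\<le>\<^sub>0" "G p \<noteq> 0"
    using that d cI a(2) a'(2) I J by (auto simp: A_def rGamma_eq_zero_iff)
  ultimately show ?thesis by blast
qed

section \<open>Linear independence of the residue series\<close>

text \<open>Restricted to nonzero \<open>z\<close> because the series will arise at
  \<open>z = exp l\<close>. The limit at 0 gives \<open>a 0 = 0\<close>; then any nonzero
  coefficient would make 0 an isolated zero of the sum.\<close>

lemma powser_zero_coeffs:
  fixes a :: "nat \<Rightarrow> complex"
  assumes "\<And>z. z \<noteq> 0 \<Longrightarrow> (\<lambda>i. a i * z ^ i) sums 0"
  shows "a i = 0"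
proof -
  have "((\<lambda>_. 0) \<longlongrightarrow> a 0) (at (0::complex))"
    by (rule powser_limit_0_strong[where s = 1 and f = "\<lambda>_. 0"]) (use assms in auto)
  then have a0: "a 0 = 0" by (simp add: tendsto_const_iff)
  have s: "(\<lambda>i. a i * z ^ i) sums 0" for z
    using assms[of z] a0 powser_sums_zero[of a] by (cases "z = 0") auto
  show ?thesis
  proof (cases "i = 0")
    case False
    show ?thesis
    proof (rule ccontr)
      assume "a i \<noteq> 0"
      then obtain e where "e > 0" "\<And>z::complex. z \<in> cball 0 e - {0} \<Longrightarrow> (0::complex) \<noteq> 0"
        using powser_0_nonzero[of 1 0 a "\<lambda>_. 0" i] s False by auto
      from this(2)[of "of_real e"] this(1) show False by auto
    qed
  qed (use a0 in simp)
qed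

lemma poly_cis_turn_exp_type: "exp_type (\<lambda>\<omega>. poly P (cis_turn \<omega>))"
  unfolding poly_altdef by (intro exp_type_sum exp_type_mult exp_type_const exp_type_power exp_type_exp)

text \<open>At the top parameter \<open>\<alpha> s\<close> of a class all Gamma factors of
  \<open>I s k\<close> have poles and no reciprocal factor vanishes, so the kernel has a pole of
  order exactly \<open>k\<close> there. Pole orders thus separate the terms of one class, and turn
  factors separate the classes. The offsets \<open>\<tau> k\<close> allow for the arguments
  \<open>(-1) ^ k * \<zeta>\<close> of the logarithm.\<close>

lemma gamma_residue_sums_independent:
  fixes b :: "nat \<Rightarrow> complex" and I :: "nat \<Rightarrow> nat \<Rightarrow> nat set" and \<alpha> :: "nat \<Rightarrow> complex"
    and \<beta> :: "nat \<Rightarrow> nat \<Rightarrow> complex" and c :: "nat \<Rightarrow> nat \<Rightarrow> complex" and \<tau> :: "nat \<Rightarrow> complex"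
  assumes J: "finite J" "J \<noteq> {}"
    and I: "\<And>s k. s \<in> {1..r} \<Longrightarrow> k \<in> {1..n s} \<Longrightarrow> I s k \<subseteq> J"
      "\<And>s k. s \<in> {1..r} \<Longrightarrow> k \<in> {1..n s} \<Longrightarrow> card (I s k) = k"
    and \<beta>: "\<And>s k j. s \<in> {1..r} \<Longrightarrow> k \<in> {1..n s} \<Longrightarrow> j \<in> I s k \<Longrightarrow> b j - \<beta> s k \<in> \<nat>"
    and \<alpha>: "\<And>s k j. s \<in> {1..r} \<Longrightarrow> k \<in> {1..n s} \<Longrightarrow> j \<in> I s k \<Longrightarrow> \<alpha> s - b j \<in> \<nat>"
      "\<And>s k j. s \<in> {1..r} \<Longrightarrow> k \<in> {1..n s} \<Longrightarrow> j \<in> J - I s k \<Longrightarrow> 1 - b j + \<alpha> s \<notin> \<int>\<^sub>\<le>\<^sub>0"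
      "\<And>s s'. s \<in> {1..r} \<Longrightarrow> s' \<in> {1..r} \<Longrightarrow> s \<noteq> s' \<Longrightarrow> \<alpha> s - \<alpha> s' \<notin> \<int>"
    and zero: "\<And>l. (\<Sum>s=1..r. \<Sum>k=1..n s. c s k *
        residue_sum (\<beta> s k) (\<lambda>\<omega>. gamma_quot b (I s k) J \<omega> * exp (\<omega> * (l + \<tau> k)))) = 0"
    and s0: "s0 \<in> {1..r}" and k0: "k0 \<in> {1..n s0}"
  shows "c s0 k0 = 0"
proof (rule ccontr)
  assume "c s0 k0 \<noteq> 0"
  \<comment> \<open>The surviving term of highest pole order in the class \<open>s0\<close>; it will
    be isolated.\<close>
  define K where "K = Max {k \<in> {1..n s0}. c s0 k \<noteq> 0}"
  have "K \<in> {k \<in> {1..n s0}. c s0 k \<noteq> 0}"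
    unfolding K_def by (rule Max_in) (use k0 \<open>c s0 k0 \<noteq> 0\<close> in auto)
  then have K: "K \<in> {1..n s0}" "c s0 K \<noteq> 0" by auto
  have Kmax: "c s0 k = 0" if "k \<in> {1..n s0}" "k > K" for k
    using that Max_ge[of "{k \<in> {1..n s0}. c s0 k \<noteq> 0}" k] unfolding K_def by fastforce
  \<comment> \<open>In a class other than \<open>s0\<close>, pole orders are at most
    \<open>n s\<close>, so \<open>n s\<close> turn factors remove all poles; in \<open>s0\<close>,
    \<open>K - 1\<close> of them remove the poles of the terms below \<open>K\<close> and make those
    of the term \<open>K\<close> at most simple.\<close>
  define mu where "mu s = (if s = s0 then K - 1 else n s)" for s
  define P where "P = (\<Prod>s\<in>{1..r}. [:- cis_turn (\<alpha> s), 1:] ^ mu s)"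
  define Qr where "Qr s \<omega> = (\<Prod>s'\<in>{1..r} - {s}. (cis_turn \<omega> - cis_turn (\<alpha> s')) ^ mu s')" for s \<omega>
  define Q where "Q \<omega> = poly P (cis_turn \<omega>)" for \<omega>
  have Q_fact: "Q \<omega> = (cis_turn \<omega> - cis_turn (\<alpha> s)) ^ mu s * Qr s \<omega>" if "s \<in> {1..r}" for s \<omega>
  proof -
    have "Q \<omega> = (\<Prod>s\<in>{1..r}. (cis_turn \<omega> - cis_turn (\<alpha> s)) ^ mu s)"
      by (simp add: Q_def P_def poly_prod)
    then show ?thesis using that by (simp add: Qr_def prod.remove)
  qed
  define H where "H s k = gamma_quot b (I s k) J" for s k
  have kern: "rapid_kernel (\<beta> s k) (H s k)" if "s \<in> {1..r}" "k \<in> {1..n s}" for s k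
    unfolding H_def using I(1)[OF that] \<beta>[OF that] by (intro gamma_quot_rapid_kernel J)
  define Rs where "Rs s k l = residue_sum (\<beta> s k) (\<lambda>\<omega>. H s k \<omega> * (Q \<omega> * exp (\<omega> * (l + \<tau> k))))" for s k l
  \<comment> \<open>Multiplying the integrand by \<open>cis_turn \<omega> ^ i\<close> translates
    \<open>l\<close> by \<open>i\<close> times 2\<pi>i, so inserting \<open>Q\<close> combines the
    relation \<open>zero\<close> at translated points.\<close>
  have Qexp: "Q \<omega> * exp (\<omega> * l) = (\<Sum>i\<le>degree P. coeff P i * exp (\<omega> * (l + of_nat i * (2 * of_real pi * \<i>))))" for \<omega> l
  proof -
    have "cis_turn \<omega> ^ i * exp (\<omega> * l) = exp (\<omega> * (l + of_nat i * (2 * of_real pi * \<i>)))" for i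
      by (subst exp_of_nat_mult[symmetric], subst exp_add[symmetric]) (simp add: algebra_simps)
    then show ?thesis unfolding Q_def poly_altdef by (simp add: sum_distrib_right mult.assoc)
  qed
  have Rs_sum: "Rs s k l = (\<Sum>i\<le>degree P. coeff P i *
      residue_sum (\<beta> s k) (\<lambda>\<omega>. H s k \<omega> * exp (\<omega> * ((l + of_nat i * (2 * of_real pi * \<i>)) + \<tau> k))))"
    if "s \<in> {1..r}" "k \<in> {1..n s}" for s k l
    unfolding Rs_def Qexp
    by (subst residue_sum_finite_sum[OF kern[OF that]]) (auto simp: add_ac)
  have zero': "(\<Sum>s=1..r. \<Sum>k=1..n s. c s k * Rs s k l) = 0" for l
  proof -
    have "(\<Sum>s=1..r. \<Sum>k=1..n s. c s k * Rs s k l) = (\<Sum>s=1..r. \<Sum>k=1..n s. \<Sum>i\<le>degree P. coeff P i *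
       (c s k * residue_sum (\<beta> s k) (\<lambda>\<omega>. H s k \<omega> * exp (\<omega> * ((l + of_nat i * (2 * of_real pi * \<i>)) + \<tau> k)))))"
      by (intro sum.cong refl) (simp add: Rs_sum sum_distrib_left mult_ac)
    also have "\<dots> = (\<Sum>s=1..r. \<Sum>i\<le>degree P. \<Sum>k=1..n s. coeff P i *
       (c s k * residue_sum (\<beta> s k) (\<lambda>\<omega>. H s k \<omega> * exp (\<omega> * ((l + of_nat i * (2 * of_real pi * \<i>)) + \<tau> k)))))"
      by (intro sum.cong refl sum.swap)
    also have "\<dots> = (\<Sum>i\<le>degree P. \<Sum>s=1..r. \<Sum>k=1..n s. coeff P i *
       (c s k * residue_sum (\<beta> s k) (\<lambda>\<omega>. H s k \<omega> * exp (\<omega> * ((l + of_nat i * (2 * of_real pi * \<i>)) + \<tau> k)))))"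
      by (rule sum.swap)
    also have "\<dots> = (\<Sum>i\<le>degree P. coeff P i * (\<Sum>s=1..r. \<Sum>k=1..n s.
       c s k * residue_sum (\<beta> s k) (\<lambda>\<omega>. H s k \<omega> * exp (\<omega> * ((l + of_nat i * (2 * of_real pi * \<i>)) + \<tau> k)))))"
      by (simp only: sum_distrib_left)
    also have "\<dots> = 0" unfolding H_def zero by simp
    finally show ?thesis .
  qed
  have lim: "\<exists>a. ((\<lambda>\<omega>. H s k \<omega> * Q \<omega> * (\<omega> - p)) \<longlongrightarrow> a) (at p) \<and> (mu s \<ge> k \<longrightarrow> a = 0) \<and>
      (s = s0 \<longrightarrow> k = K \<longrightarrow> p = \<alpha> s0 \<longrightarrow> a \<noteq> 0)"
    if sk: "s \<in> {1..r}" "k \<in> {1..n s}" and mu: "mu s \<ge> k - 1" and p: "p - \<alpha> s \<in> \<int>" for s k p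
  proof -
    have "I s k \<noteq> {}" using I(2)[OF sk] sk by auto
    moreover have "isCont (Qr s) p" unfolding Qr_def by (intro continuous_intros)
    ultimately obtain a where a: "((\<lambda>\<omega>. H s k \<omega> * ((cis_turn \<omega> - cis_turn p) ^ mu s * Qr s \<omega>) * (\<omega> - p)) \<longlongrightarrow> a) (at p)"
      "mu s \<ge> k \<longrightarrow> a = 0"
      "mu s = k - 1 \<longrightarrow> (\<forall>j\<in>I s k. p - b j \<in> \<nat>) \<longrightarrow> (\<forall>j\<in>J - I s k. 1 - b j + p \<notin> \<int>\<^sub>\<le>\<^sub>0) \<longrightarrow> Qr s p \<noteq> 0 \<longrightarrow> a \<noteq> 0"
      using gamma_quot_turn_limit[OF J(1) I(1)[OF sk], where m = "mu s" and G = "Qr s" and p = p and b = b] mu I(2)[OF sk] unfolding H_def by auto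
    \<comment> \<open>By periodicity the turn factor built at \<open>\<alpha> s\<close> serves at
      every point of the same class.\<close>
    have "cis_turn p = cis_turn (\<alpha> s)" using p by (simp only: cis_turn_eq_iff)
    then have "((\<lambda>\<omega>. H s k \<omega> * Q \<omega> * (\<omega> - p)) \<longlongrightarrow> a) (at p)" using a(1) by (simp only: Q_fact[OF sk(1)])
    moreover have "a \<noteq> 0" if "s = s0" "k = K" "p = \<alpha> s0"
    proof -
      have "Qr s p \<noteq> 0" unfolding Qr_def using that sk \<alpha>(3)[OF sk(1)] by (auto simp: cis_turn_eq_iff)
      then show ?thesis using a(3) \<alpha>(1,2)[OF sk] that by (auto simp: mu_def)
    qed
    ultimately show ?thesis using a(2) by blast
  qed
  have ray_class: "\<beta> s k + of_nat i - \<alpha> s \<in> \<int>" if sk: "s \<in> {1..r}" "k \<in> {1..n s}" for s k i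
  proof -
    obtain j where j: "j \<in> I s k" using I(2)[OF sk] sk by fastforce
    have "b j - \<beta> s k \<in> \<int>" "\<alpha> s - b j \<in> \<int>" using \<beta>[OF sk j] \<alpha>(1)[OF sk j] Nats_subset_Ints by auto
    then have "of_nat i - (b j - \<beta> s k) - (\<alpha> s - b j) \<in> \<int>"
      by (rule Ints_diff[OF Ints_diff[OF Ints_of_nat]])
    then show ?thesis by (simp add: algebra_simps)
  qed
  \<comment> \<open>With at most a simple pole left, \<open>exp (\<omega> * l)\<close> enters the
    residue only through its value at the pole, without powers of \<open>l\<close>.\<close>
  have res: "residue (\<lambda>\<omega>. H s k \<omega> * (Q \<omega> * exp (\<omega> * l))) (\<beta> s k + of_nat i) = a * exp ((\<beta> s k + of_nat i) * l)"
    if sk: "s \<in> {1..r}" "k \<in> {1..n s}" and a: "((\<lambda>\<omega>. H s k \<omega> * Q \<omega> * (\<omega> - (\<beta> s k + of_nat i))) \<longlongrightarrow> a) (at (\<beta> s k + of_nat i))"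
    for s k i a l
  proof (rule residue_simple'[of "ball (\<beta> s k + of_nat i) 1"])
    have "rapid_kernel (\<beta> s k) (\<lambda>\<omega>. H s k \<omega> * (Q \<omega> * exp (\<omega> * l)))"
      unfolding Q_def by (intro rapid_kernel_mult kern sk exp_type_mult poly_cis_turn_exp_type exp_type_exp)
    then show "(\<lambda>\<omega>. H s k \<omega> * (Q \<omega> * exp (\<omega> * l))) holomorphic_on ball (\<beta> s k + of_nat i) 1 - {\<beta> s k + of_nat i}"
      unfolding rapid_kernel_def by (auto intro: holomorphic_on_subset[OF _ ray_minus_singleton])
    have "((\<lambda>\<omega>. (H s k \<omega> * Q \<omega> * (\<omega> - (\<beta> s k + of_nat i))) * exp (\<omega> * l)) \<longlongrightarrow> a * exp ((\<beta> s k + of_nat i) * l)) (at (\<beta> s k + of_nat i))"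
      by (intro tendsto_intros a)
    then show "((\<lambda>\<omega>. H s k \<omega> * (Q \<omega> * exp (\<omega> * l)) * (\<omega> - (\<beta> s k + of_nat i))) \<longlongrightarrow> a * exp ((\<beta> s k + of_nat i) * l)) (at (\<beta> s k + of_nat i))"
      by (simp add: mult_ac)
  qed auto
  have Rs0: "Rs s k l = 0" if sk: "s \<in> {1..r}" "k \<in> {1..n s}" and mu: "mu s \<ge> k" for s k l
  proof -
    have "residue (\<lambda>\<omega>. H s k \<omega> * (Q \<omega> * exp (\<omega> * (l + \<tau> k)))) (\<beta> s k + of_nat i) = 0" for i
    proof -
      obtain a where "((\<lambda>\<omega>. H s k \<omega> * Q \<omega> * (\<omega> - (\<beta> s k + of_nat i))) \<longlongrightarrow> a) (at (\<beta> s k + of_nat i))" "a = 0"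
        using lim[OF sk _ ray_class[OF sk, of i]] mu by auto
      from res[OF sk this(1)] this(2) show ?thesis by simp
    qed
    then show ?thesis unfolding Rs_def residue_sum_def by simp
  qed
  \<comment> \<open>\<open>Q\<close> need not remove the poles of the terms \<open>k > K\<close> of
    \<open>s0\<close>, but their coefficients vanish by the choice of \<open>K\<close>.\<close>
  have term0: "c s k * Rs s k l = 0" if "s \<in> {1..r}" "k \<in> {1..n s}" "(s, k) \<noteq> (s0, K)" for s k l
  proof (cases "mu s \<ge> k")
    case True
    then show ?thesis using Rs0 that by simp
  next
    case False
    then have "s = s0" "k > K" using that by (auto simp: mu_def split: if_splits)
    then show ?thesis using Kmax that by simp
  qed
  have Rtop: "Rs s0 K l = 0" for l
  proof -
    have "0 = (\<Sum>s=1..r. \<Sum>k=1..n s. c s k * Rs s k l)" using zero' by simp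
    also have "\<dots> = (\<Sum>s=1..r. if s = s0 then c s0 K * Rs s0 K l else 0)"
    proof (rule sum.cong[OF refl])
      fix s assume s: "s \<in> {1..r}"
      have "(\<Sum>k=1..n s. c s k * Rs s k l) = (\<Sum>k=1..n s. if s = s0 \<and> k = K then c s0 K * Rs s0 K l else 0)"
        by (intro sum.cong refl) (use term0[OF s] in auto)
      also have "\<dots> = (if s = s0 then c s0 K * Rs s0 K l else 0)" using K(1) by (cases "s = s0") auto
      finally show "(\<Sum>k=1..n s. c s k * Rs s k l) = (if s = s0 then c s0 K * Rs s0 K l else 0)" .
    qed
    also have "\<dots> = c s0 K * Rs s0 K l" using s0 by simp
    finally show ?thesis using K(2) by simp
  qed
  have "\<forall>i. \<exists>a. ((\<lambda>\<omega>. H s0 K \<omega> * Q \<omega> * (\<omega> - (\<beta> s0 K + of_nat i))) \<longlongrightarrow> a) (at (\<beta> s0 K + of_nat i)) \<and>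
      (\<beta> s0 K + of_nat i = \<alpha> s0 \<longrightarrow> a \<noteq> 0)"
  proof
    fix i
    have "mu s0 \<ge> K - 1" by (simp add: mu_def)
    from lim[OF s0 K(1) this ray_class[OF s0 K(1), of i]]
    show "\<exists>a. ((\<lambda>\<omega>. H s0 K \<omega> * Q \<omega> * (\<omega> - (\<beta> s0 K + of_nat i))) \<longlongrightarrow> a) (at (\<beta> s0 K + of_nat i)) \<and>
      (\<beta> s0 K + of_nat i = \<alpha> s0 \<longrightarrow> a \<noteq> 0)" by blast
  qed
  then obtain a where a: "\<And>i. ((\<lambda>\<omega>. H s0 K \<omega> * Q \<omega> * (\<omega> - (\<beta> s0 K + of_nat i))) \<longlongrightarrow> a i) (at (\<beta> s0 K + of_nat i))"
      "\<And>i. \<beta> s0 K + of_nat i = \<alpha> s0 \<Longrightarrow> a i \<noteq> 0" by metis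
  \<comment> \<open>Every nonzero \<open>z\<close> is \<open>exp (l + \<tau> K)\<close> for some
    \<open>l\<close>; up to the nonzero factor \<open>exp (\<beta> s0 K * (l + \<tau> K))\<close>,
    the vanishing residue sum is a power series in \<open>z\<close>.\<close>
  have "(\<lambda>i. a i * z ^ i) sums 0" if z: "z \<noteq> 0" for z
  proof -
    define l where "l = Ln z - \<tau> K"
    have lz: "exp (l + \<tau> K) = z" using z by (simp add: l_def)
    have "rapid_kernel (\<beta> s0 K) (\<lambda>\<omega>. H s0 K \<omega> * (Q \<omega> * exp (\<omega> * (l + \<tau> K))))"
      unfolding Q_def by (intro rapid_kernel_mult kern s0 K exp_type_mult poly_cis_turn_exp_type exp_type_exp)
    from rapid_kernel_residue_sums[OF this]
    have "(\<lambda>i. a i * exp ((\<beta> s0 K + of_nat i) * (l + \<tau> K))) sums 0"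
      using Rtop[of l] unfolding Rs_def by (simp add: res[OF s0 K(1) a(1)])
    moreover have "exp ((\<beta> s0 K + of_nat i) * (l + \<tau> K)) = exp (\<beta> s0 K * (l + \<tau> K)) * z ^ i" for i
      unfolding lz[symmetric] exp_of_nat_mult[symmetric] exp_add[symmetric] by (simp add: algebra_simps)
    ultimately have "(\<lambda>i. exp (\<beta> s0 K * (l + \<tau> K)) * (a i * z ^ i)) sums (exp (\<beta> s0 K * (l + \<tau> K)) * 0)"
      by (simp add: mult_ac)
    then show ?thesis by (subst (asm) sums_mult_iff) auto
  qed
  from powser_zero_coeffs[OF this] have a0: "a i = 0" for i .
  obtain j where j: "j \<in> I s0 K" using I(2)[OF s0 K(1)] K(1) by fastforce
  \<comment> \<open>\<open>\<alpha> s0\<close> lies on the ray, and the coefficient belonging to it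
    is nonzero.\<close>
  have "(b j - \<beta> s0 K) + (\<alpha> s0 - b j) \<in> \<nat>" using \<beta>[OF s0 K(1) j] \<alpha>(1)[OF s0 K(1) j] by (rule Nats_add)
  then obtain i where "(b j - \<beta> s0 K) + (\<alpha> s0 - b j) = of_nat i" by (elim Nats_cases)
  then have "\<beta> s0 K + of_nat i = \<alpha> s0" by (simp add: algebra_simps)
  with a(2) a0 show False by blast
qed

section \<open>Blocks of parameters, and the solutions as residue series\<close>

lemma blk_end_le:
  assumes "s \<in> {1..r}"
  shows "blk_start n s + n s \<le> (\<Sum>t=1..r. n t)"
proof -
  have "blk_start n s + n s = (\<Sum>t=1..<Suc s. n t)"
    using assms by (simp add: blk_start_def)
  also have "\<dots> \<le> (\<Sum>t=1..r. n t)" by (rule sum_mono2) (use assms in auto)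
  finally show ?thesis .
qed

lemma block_of_index:
  assumes "1 \<le> j" "j \<le> (\<Sum>t=1..r. n t)"
  shows "\<exists>s\<in>{1..r}. \<exists>k\<in>{1..n s}. j = blk_start n s + k"
  using assms
proof (induction r)
  case (Suc r)
  show ?case
  proof (cases "j \<le> (\<Sum>t=1..r. n t)")
    case True
    then obtain s k where "s \<in> {1..r}" "k \<in> {1..n s}" "j = blk_start n s + k" using Suc by blast
    then show ?thesis by (intro bexI[of _ s] bexI[of _ k]) auto
  next
    case False
    have "blk_start n (Suc r) = (\<Sum>t=1..r. n t)"
      unfolding blk_start_def by (rule sum.cong) auto
    then show ?thesis using False Suc.prems
      by (intro bexI[of _ "Suc r"] bexI[of _ "j - blk_start n (Suc r)"]) auto
  qed
qed simp

lemma Ints_nonneg_Re_imp_Nats: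
  assumes "(z::complex) \<in> \<int>" "Re z \<ge> 0"
  shows "z \<in> \<nat>"
proof -
  obtain m where "z = of_int m" using assms(1) by (elim Ints_cases)
  then have "z = of_nat (nat m)" using assms(2) by simp
  then show ?thesis by simp
qed

text \<open>The ray starts at the last parameter of the first group, the lowest one; those of the
  other parameters are contained in it.\<close>

lemma meijer_sol_eq_residue_sum:
  fixes b :: "nat \<Rightarrow> complex"
  assumes k: "k \<ge> 1" "blk_start n s + k \<le> q"
    and b: "\<And>j. j \<in> {blk_start n s + 1..blk_start n s + k} \<Longrightarrow> b j - b (blk_start n s + k) \<in> \<nat>"
  shows "meijer_sol L b q n s k \<zeta> = - residue_sum (b (blk_start n s + k))
    (\<lambda>\<omega>. gamma_quot b {blk_start n s + 1..blk_start n s + k} {1..q} \<omega> * exp (\<omega> * L ((-1) ^ k * \<zeta>)))"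
proof -
  define N where "N = blk_start n s"
  define cs where "cs = map b [N + 1..<N + k + 1]"
  define ds where "ds = map b (filter (\<lambda>j. j \<notin> {N + 1..N + k}) [1..<q + 1])"
  let ?x = "(-1) ^ k * \<zeta>"
  have s1: "set [N + 1..<N + k + 1] = {N + 1..N + k}" by auto
  have s2: "set (filter (\<lambda>j. j \<notin> {N + 1..N + k}) [1..<q + 1]) = {1..q} - {N + 1..N + k}" by auto
  have "(\<Prod>c\<leftarrow>cs. Gamma (c - \<omega>)) = (\<Prod>j\<in>{N + 1..N + k}. Gamma (b j - \<omega>))" for \<omega>
    unfolding cs_def map_map o_def s1[symmetric] by (rule prod.distinct_set_conv_list[symmetric]) simp
  moreover have "(\<Prod>d\<leftarrow>ds. Gamma (1 - d + \<omega>)) = (\<Prod>j\<in>{1..q} - {N + 1..N + k}. Gamma (1 - b j + \<omega>))" for \<omega>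
    unfolding ds_def map_map o_def s2[symmetric] by (rule prod.distinct_set_conv_list[symmetric]) simp
  \<comment> \<open>Division agrees with \<open>rGamma\<close> even at the poles of the
    denominators, as \<open>Gamma\<close> has the value 0 there and
    \<open>inverse 0 = 0\<close>.\<close>
  ultimately have int: "meijerG_integrand L cs ds ?x = (\<lambda>\<omega>. gamma_quot b {N + 1..N + k} {1..q} \<omega> * exp (\<omega> * L ?x))"
    unfolding meijerG_integrand_def gamma_quot_def
    by (simp add: fun_eq_iff divide_inverse rGamma_inverse_Gamma prod_inversef[symmetric] o_def)
  have poles: "meijerG_poles cs = ray (b (N + k))"
    by (rule meijerG_poles_eq_ray) (use k b in \<open>auto simp: cs_def N_def\<close>)
  have "rapid_kernel (b (N + k)) (\<lambda>\<omega>. gamma_quot b {N + 1..N + k} {1..q} \<omega> * exp (\<omega> * L ?x))"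
    using k b by (intro rapid_kernel_mult gamma_quot_rapid_kernel exp_type_exp) (auto simp: N_def)
  from infsum_residue_ray[OF this] have "meijerG L cs ds ?x =
      - residue_sum (b (N + k)) (\<lambda>\<omega>. gamma_quot b {N + 1..N + k} {1..q} \<omega> * exp (\<omega> * L ?x))"
    unfolding meijerG_def int poles by simp
  then show ?thesis unfolding meijer_sol_def cs_def ds_def N_def by simp
qed

text \<open>Differentiating \<open>exp (L (\<epsilon> * z)) = \<epsilon> * z\<close> determines the
  derivative; the constant \<epsilon>, later \<open>(-1) ^ k\<close>, cancels.\<close>

lemma log_branch_has_derivative:
  assumes L: "L holomorphic_on - log_cut w" "\<forall>z. z \<notin> log_cut w \<longrightarrow> exp (L z) = z"
    and D: "open D" "\<And>z. z \<in> D \<Longrightarrow> \<epsilon> * z \<notin> log_cut w" and \<epsilon>: "\<epsilon> \<noteq> 0" and z: "z \<in> D"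
  shows "((\<lambda>z. L (\<epsilon> * z)) has_field_derivative inverse z) (at z)"
proof -
  let ?M = "\<lambda>z. L (\<epsilon> * z)"
  have "(L \<circ> (*) \<epsilon>) holomorphic_on D"
    by (rule holomorphic_on_compose_gen[OF _ L(1)]) (use D(2) in \<open>auto intro!: holomorphic_intros\<close>)
  then have M: "(?M has_field_derivative deriv ?M z) (at z)"
    using holomorphic_derivI[OF _ D(1) z] by (simp add: o_def)
  have E: "exp (?M z) = \<epsilon> * z" if "z \<in> D" for z using L(2) D(2)[OF that] by blast
  have "((\<lambda>z. exp (?M z)) has_field_derivative exp (?M z) * deriv ?M z) (at z)"
    by (rule DERIV_chain2[OF DERIV_exp M])
  then have "((\<lambda>z. \<epsilon> * z) has_field_derivative exp (?M z) * deriv ?M z) (at z)"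
    by (rule has_field_derivative_transform_within_open[OF _ D(1) z]) (simp add: E)
  moreover have "((\<lambda>z. \<epsilon> * z) has_field_derivative \<epsilon>) (at z)"
    by (auto intro!: derivative_eq_intros)
  ultimately have "\<epsilon> * z * deriv ?M z = \<epsilon>" using DERIV_unique E[OF z] by metis
  then have "z * deriv ?M z = 1" using \<epsilon> by simp
  then have "deriv ?M z = inverse z" by (metis inverse_unique)
  then show ?thesis using M by simp
qed

section \<open>The hypergeometric form\<close>

text \<open>With a single Gamma factor all poles are at most simple. The sign
  \<open>(-1) ^ i\<close> of its residues combines with \<open>(-\<zeta>) ^ i\<close> from the
  exponential into \<open>\<zeta> ^ i\<close>, and the recurrence of \<open>rGamma\<close> supplies
  the Pochhammer symbols.\<close>

lemma residue_sum_single_gamma: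
  fixes b :: "nat \<Rightarrow> complex"
  assumes J: "finite J" "j0 \<in> J" and nz: "\<And>j. j \<in> J \<Longrightarrow> 1 + b j0 - b j \<notin> \<int>\<^sub>\<le>\<^sub>0"
    and x: "exp l = - \<zeta>"
  shows "- residue_sum (b j0) (\<lambda>\<omega>. gamma_quot b {j0} J \<omega> * exp (\<omega> * l)) =
    exp (b j0 * l) / (\<Prod>j\<in>J. Gamma (1 + b j0 - b j)) *
    (\<Sum>k. \<zeta> ^ k / (fact k * (\<Prod>j\<in>J - {j0}. pochhammer (1 + b j0 - b j) k)))"
proof -
  let ?\<beta> = "b j0"
  define g where "g \<omega> = (\<Prod>j\<in>J - {j0}. rGamma (1 - b j + \<omega>))" for \<omega>
  define C where "C = exp (?\<beta> * l) / (\<Prod>j\<in>J. Gamma (1 + ?\<beta> - b j))"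
  define t where "t k = \<zeta> ^ k / (fact k * (\<Prod>j\<in>J - {j0}. pochhammer (1 + ?\<beta> - b j) k))" for k
  have kern: "rapid_kernel ?\<beta> (\<lambda>\<omega>. gamma_quot b {j0} J \<omega> * exp (\<omega> * l))"
    using J by (intro rapid_kernel_mult gamma_quot_rapid_kernel exp_type_exp) auto
  have "C \<noteq> 0" unfolding C_def using nz J by (auto simp: Gamma_eq_zero_iff)
  \<comment> \<open>The factor at \<open>j0\<close> is \<open>Gamma 1 = 1\<close>, so the product
    over all of \<open>J\<close> is harmless.\<close>
  have "(\<Prod>j\<in>J. Gamma (1 + ?\<beta> - b j)) = Gamma (1 + ?\<beta> - b j0) * (\<Prod>j\<in>J - {j0}. Gamma (1 + ?\<beta> - b j))"
    using J by (rule prod.remove)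
  then have C: "C = exp (?\<beta> * l) * (\<Prod>j\<in>J - {j0}. rGamma (1 + ?\<beta> - b j))"
    unfolding C_def by (simp add: rGamma_inverse_Gamma divide_inverse prod_inversef[symmetric] o_def)
  have res: "residue (\<lambda>\<omega>. gamma_quot b {j0} J \<omega> * exp (\<omega> * l)) (?\<beta> + of_nat i) = - (C * t i)" for i
  proof -
    let ?p = "?\<beta> + of_nat i"
    have "((\<lambda>\<omega>. Gamma (?\<beta> - \<omega>) * (\<omega> - ?p)) \<longlongrightarrow> - ((-1) ^ i / fact i)) (at ?p)"
      by (rule Gamma_reflected_residue_limit) simp
    moreover have "(g \<longlongrightarrow> g ?p) (at ?p)" unfolding g_def by (intro isContD continuous_intros)
    moreover have "((\<lambda>\<omega>. exp (\<omega> * l)) \<longlongrightarrow> exp (?p * l)) (at ?p)" by (intro tendsto_intros)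
    ultimately have "((\<lambda>\<omega>. (Gamma (?\<beta> - \<omega>) * (\<omega> - ?p)) * g \<omega> * exp (\<omega> * l)) \<longlongrightarrow>
       - ((-1) ^ i / fact i) * g ?p * exp (?p * l)) (at ?p)"
      by (intro tendsto_mult)
    then have lim: "((\<lambda>\<omega>. gamma_quot b {j0} J \<omega> * exp (\<omega> * l) * (\<omega> - ?p)) \<longlongrightarrow>
       - ((-1) ^ i / fact i) * g ?p * exp (?p * l)) (at ?p)"
      by (simp add: gamma_quot_def g_def mult_ac)
    have "residue (\<lambda>\<omega>. gamma_quot b {j0} J \<omega> * exp (\<omega> * l)) ?p = - ((-1) ^ i / fact i) * g ?p * exp (?p * l)"
      by (rule residue_simple'[OF _ _ _ lim, of "ball ?p 1"])
         (use kern ray_minus_singleton[of ?\<beta> i] in \<open>auto simp: rapid_kernel_def intro: holomorphic_on_subset\<close>)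
    moreover have "exp (?p * l) = exp (?\<beta> * l) * (-\<zeta>) ^ i"
      unfolding x[symmetric] exp_of_nat_mult[symmetric] exp_add[symmetric] by (simp add: algebra_simps)
    moreover have "g ?p = (\<Prod>j\<in>J - {j0}. rGamma (1 + ?\<beta> - b j)) / (\<Prod>j\<in>J - {j0}. pochhammer (1 + ?\<beta> - b j) i)"
    proof -
      have "rGamma (1 - b j + ?p) = rGamma (1 + ?\<beta> - b j) / pochhammer (1 + ?\<beta> - b j) i" if j: "j \<in> J - {j0}" for j
      proof -
        have "pochhammer (1 + ?\<beta> - b j) i \<noteq> 0"
          using nz[of j] j by (auto simp: pochhammer_eq_0_iff)
        moreover have "1 - b j + ?p = (1 + ?\<beta> - b j) + of_nat i" by simp
        ultimately show ?thesis using pochhammer_rGamma[of "1 + ?\<beta> - b j" i] by (simp add: field_simps)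
      qed
      then show ?thesis unfolding g_def prod_dividef[symmetric] by (rule prod.cong[OF refl])
    qed
    ultimately have "residue (\<lambda>\<omega>. gamma_quot b {j0} J \<omega> * exp (\<omega> * l)) ?p = - ((-1) ^ i / fact i) *
        ((\<Prod>j\<in>J - {j0}. rGamma (1 + ?\<beta> - b j)) / (\<Prod>j\<in>J - {j0}. pochhammer (1 + ?\<beta> - b j) i)) * (exp (?\<beta> * l) * (-\<zeta>) ^ i)"
      by (simp only:)
    also have "\<dots> = - (C * (((-1) ^ i * (-\<zeta>) ^ i) / (fact i * (\<Prod>j\<in>J - {j0}. pochhammer (1 + ?\<beta> - b j) i))))"
      unfolding C by simp
    also have "(-1) ^ i * (-\<zeta>) ^ i = \<zeta> ^ i" by (subst power_mult_distrib[symmetric]) simp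
    finally show ?thesis unfolding t_def .
  qed
  have "(\<lambda>i. - (C * t i)) sums residue_sum ?\<beta> (\<lambda>\<omega>. gamma_quot b {j0} J \<omega> * exp (\<omega> * l))"
    using rapid_kernel_residue_sums[OF kern] by (simp add: res)
  from sums_minus[OF this]
  have s: "(\<lambda>i. C * t i) sums - residue_sum ?\<beta> (\<lambda>\<omega>. gamma_quot b {j0} J \<omega> * exp (\<omega> * l))" by simp
  \<comment> \<open>Convergence of the hypergeometric series is inherited from the residue series,
    on division by \<open>C \<noteq> 0\<close>.\<close>
  have "summable t" using sums_summable[OF s] \<open>C \<noteq> 0\<close> by (simp add: summable_cmult_iff)
  from suminf_mult[OF this, of C] show ?thesis
    using sums_unique[OF s] unfolding C_def[symmetric] t_def by simp
qed

section \<open>The fundamental system and the first solution of each block\<close>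

theorem theorem3p1:
  fixes q r :: nat and n :: "nat \<Rightarrow> nat" and b :: "nat \<Rightarrow> complex"
    and w :: complex and L :: "complex \<Rightarrow> complex" and D :: "complex set"
  assumes r_pos: "r \<ge> 1"
    and n_pos: "\<forall>s\<in>{1..r}. n s \<ge> 1"
    and n_sum: "(\<Sum>s=1..r. n s) = q"
    and blocks: "\<forall>s\<in>{1..r}. \<forall>s'\<in>{1..r}. \<forall>k\<in>{1..n s}. \<forall>k'\<in>{1..n s'}.
                   (b (blk_start n s + k) - b (blk_start n s' + k') \<in> \<int> \<longleftrightarrow> s = s')"
    and order: "\<forall>s\<in>{1..r}. \<forall>k\<in>{1..<n s}.
                   Re (b (blk_start n s + k)) \<ge> Re (b (blk_start n s + k + 1))"
    and w_nz: "w \<noteq> 0"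
    and L_hol: "L holomorphic_on (- log_cut w)"
    and L_exp: "\<forall>z. z \<notin> log_cut w \<longrightarrow> exp (L z) = z"
    and D_open: "open D" and D_conn: "connected D" and D_sc: "simply_connected D"
    and D_ne: "D \<noteq> {}"
    and D_sub: "D \<subseteq> {\<zeta>. \<zeta> \<notin> log_cut w \<and> - \<zeta> \<notin> log_cut w}"
  shows "(\<forall>s\<in>{1..r}. \<forall>k\<in>{1..n s}.
            meijer_sol L b q n s k holomorphic_on D \<and>
            (\<forall>\<zeta>\<in>D. euler_prod (map b [1..<q+1]) (meijer_sol L b q n s k) \<zeta>
                       - \<zeta> * meijer_sol L b q n s k \<zeta> = 0))
       \<and> (\<forall>c :: nat \<Rightarrow> nat \<Rightarrow> complex.
            (\<forall>\<zeta>\<in>D. (\<Sum>s=1..r. \<Sum>k=1..n s. c s k * meijer_sol L b q n s k \<zeta>) = 0)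
            \<longrightarrow> (\<forall>s\<in>{1..r}. \<forall>k\<in>{1..n s}. c s k = 0))
       \<and> (\<forall>s\<in>{1..r}. \<forall>\<zeta>. - \<zeta> \<notin> log_cut w \<longrightarrow>
            meijer_sol L b q n s 1 \<zeta> =
              exp (b (blk_start n s + 1) * L (- \<zeta>))
              / (\<Prod>j'=1..q. Gamma (1 + b (blk_start n s + 1) - b j'))
              * hyp0F (map (\<lambda>j. 1 + b (blk_start n s + 1) - b j)
                          (filter (\<lambda>j. j \<noteq> blk_start n s + 1) [1..<q+1])) \<zeta>)"
proof -
  define J where "J = {1..q}"
  define N where "N = blk_start n"
  define I where "I s k = {N s + 1..N s + k}" for s k
  \<comment> \<open>Minus the solution in the logarithmic variable, which no longer depends on the
    branch \<open>L\<close>.\<close>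
  define F where "F s k l = residue_sum (b (N s + k)) (\<lambda>\<omega>. gamma_quot b (I s k) J \<omega> * exp (\<omega> * l))" for s k l
  have N_le: "N s + k \<le> q" if "s \<in> {1..r}" "k \<in> {1..n s}" for s k
    using blk_end_le[OF that(1), of n] that(2) n_sum by (auto simp: N_def)
  have J: "finite J" "J \<noteq> {}"
  proof -
    have "N 1 + 1 \<le> q" using r_pos n_pos by (intro N_le) auto
    then show "finite J" "J \<noteq> {}" by (auto simp: J_def)
  qed
  have I_sub: "I s k \<subseteq> J" if "s \<in> {1..r}" "k \<in> {1..n s}" for s k
    using N_le[OF that] by (auto simp: I_def J_def)
  have block_Int: "b (N s + k) - b (N s' + k') \<in> \<int> \<longleftrightarrow> s = s'"
    if "s \<in> {1..r}" "s' \<in> {1..r}" "k \<in> {1..n s}" "k' \<in> {1..n s'}" for s s' k k'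
    using blocks that unfolding N_def by blast
  have Re_mono: "Re (b (N s + k)) \<ge> Re (b (N s + k'))"
    if s: "s \<in> {1..r}" and k: "1 \<le> k" "k \<le> k'" "k' \<le> n s" for s k k'
    using k(2,3)
  proof (induction k' rule: dec_induct)
    case (step m)
    have "m \<in> {1..<n s}" using step k by auto
    then have "Re (b (N s + m)) \<ge> Re (b (N s + Suc m))"
      using order s unfolding N_def by simp
    then show ?case using step by simp
  qed simp
  have diff_Nats: "b (N s + k) - b (N s + k') \<in> \<nat>"
    if s: "s \<in> {1..r}" and k: "1 \<le> k" "k \<le> k'" "k' \<le> n s" for s k k'
    using Re_mono[OF s k] block_Int[OF s s, of k k'] k by (intro Ints_nonneg_Re_imp_Nats) auto
  have \<beta>_Nats: "b j - b (N s + k) \<in> \<nat>" if "s \<in> {1..r}" "k \<in> {1..n s}" "j \<in> I s k" for s k j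
    using diff_Nats[OF that(1), of "j - N s" k] that by (auto simp: I_def)
  have \<alpha>_Nats: "b (N s + 1) - b j \<in> \<nat>" if "s \<in> {1..r}" "k \<in> {1..n s}" "j \<in> I s k" for s k j
    using diff_Nats[OF that(1), of 1 "j - N s"] that by (auto simp: I_def)
  \<comment> \<open>Otherwise \<open>b j\<close> would lie in block \<open>s\<close>, at least 1
    above its first parameter, against the ordering.\<close>
  have \<alpha>_not_nonpos: "1 + b (N s + 1) - b j \<notin> \<int>\<^sub>\<le>\<^sub>0" if s: "s \<in> {1..r}" and j: "j \<in> J" for s j
  proof
    assume np: "1 + b (N s + 1) - b j \<in> \<int>\<^sub>\<le>\<^sub>0"
    obtain s' k' where jk: "s' \<in> {1..r}" "k' \<in> {1..n s'}" "j = N s' + k'"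
      using block_of_index[of j n r] j n_sum by (auto simp: J_def N_def)
    have ns: "1 \<in> {1..n s}" using n_pos s by auto
    have "1 + b (N s + 1) - b j - 1 \<in> \<int>" using nonpos_Ints_Int[OF np] by (rule Ints_diff) simp
    then have "b (N s + 1) - b (N s' + k') \<in> \<int>" using jk by simp
    then have "s' = s" using block_Int[OF s jk(1) ns jk(2)] by simp
    then have "b (N s + 1) - b j \<in> \<nat>" using diff_Nats[OF s, of 1 k'] jk by simp
    then obtain m where "b (N s + 1) - b j = of_nat m" by (elim Nats_cases)
    then have "1 + b (N s + 1) - b j = of_nat (Suc m)" by (simp add: algebra_simps)
    then have "of_nat (Suc m) \<in> (\<int>\<^sub>\<le>\<^sub>0 :: complex set)" using np by (simp only:)
    then show False by (simp only: of_nat_in_nonpos_Ints_iff nat.distinct)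
  qed
  have sol: "meijer_sol L b q n s k \<zeta> = - F s k (L ((-1) ^ k * \<zeta>))" if sk: "s \<in> {1..r}" "k \<in> {1..n s}" for s k \<zeta>
    using meijer_sol_eq_residue_sum[of k n s q b L \<zeta>] N_le[OF sk] \<beta>_Nats[OF sk] sk
    by (simp add: F_def N_def I_def J_def)
  have kern: "rapid_kernel (b (N s + k)) (gamma_quot b (I s k) J)" if "s \<in> {1..r}" "k \<in> {1..n s}" for s k
    by (intro gamma_quot_rapid_kernel J I_sub \<beta>_Nats that)
  have F_deriv: "\<exists>d. (F s k has_field_derivative d) (at l)" if "s \<in> {1..r}" "k \<in> {1..n s}" for s k l
    unfolding F_def by (rule exI, rule residue_sum_exp_has_derivative[OF kern[OF that]])
  have cut: "(-1) ^ k * z \<notin> log_cut w" if "z \<in> D" for z and k :: nat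
    using D_sub that by (cases "even k") auto
  have "0 \<in> log_cut w" unfolding log_cut_def by (auto intro!: exI[of _ 0])
  then have D0: "0 \<notin> D" using D_sub by auto
  have L_deriv: "((\<lambda>z. L ((-1) ^ k * z)) has_field_derivative inverse z) (at z)" if "z \<in> D" for z and k :: nat
    by (rule log_branch_has_derivative[OF L_hol L_exp D_open cut _ that]) auto
  have sol_hol: "meijer_sol L b q n s k holomorphic_on D" if sk: "s \<in> {1..r}" "k \<in> {1..n s}" for s k
  proof -
    have "\<exists>d. ((\<lambda>\<zeta>. - F s k (L ((-1) ^ k * \<zeta>))) has_field_derivative d) (at z)" if z: "z \<in> D" for z
    proof -
      obtain d where "(F s k has_field_derivative d) (at (L ((-1) ^ k * z)))" using F_deriv[OF sk] by metis
      from DERIV_minus[OF DERIV_chain2[OF this L_deriv[OF z]]] show ?thesis ..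
    qed
    then show ?thesis
      using D_open by (simp add: sol[OF sk, abs_def] holomorphic_on_open)
  qed
  have sol_ode: "euler_prod (map b [1..<q+1]) (meijer_sol L b q n s k) z - z * meijer_sol L b q n s k z = 0"
    if sk: "s \<in> {1..r}" "k \<in> {1..n s}" and z: "z \<in> D" for s k z
  proof -
    let ?M = "\<lambda>z. L ((-1) ^ k * z)"
    have prod: "(\<Prod>c\<leftarrow>map b [1..<q+1]. \<omega> - c) = (\<Prod>j\<in>J. \<omega> - b j)" for \<omega>
    proof -
      have "J = set [1..<q+1]" by (auto simp: J_def)
      then show ?thesis
        unfolding map_map o_def by (simp only: prod.distinct_set_conv_list[OF distinct_upt])
    qed
    have "euler_prod (map b [1..<q+1]) (meijer_sol L b q n s k) z =
      - residue_sum (b (N s + k)) (\<lambda>\<omega>. gamma_quot b (I s k) J \<omega> * ((\<Prod>c\<leftarrow>map b [1..<q+1]. \<omega> - c) * exp (\<omega> * ?M z)))"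
      by (rule euler_prod_residue_sum[OF kern[OF sk] D_open L_deriv D0 _ z]) (simp_all add: sol[OF sk] F_def)
    also have "\<dots> = - residue_sum (b (N s + k)) (\<lambda>\<omega>. gamma_quot b (I s k) J \<omega> * ((\<Prod>j\<in>J. \<omega> - b j) * exp (\<omega> * ?M z)))"
      by (simp only: prod)
    also have "residue_sum (b (N s + k)) (\<lambda>\<omega>. gamma_quot b (I s k) J \<omega> * ((\<Prod>j\<in>J. \<omega> - b j) * exp (\<omega> * ?M z))) = (-1) ^ card (I s k) * exp (?M z) * F s k (?M z)"
      unfolding F_def by (rule residue_sum_functional_equation[OF J I_sub[OF sk] \<beta>_Nats[OF sk]])
    also have "exp (?M z) = (-1) ^ k * z" using L_exp cut[OF z] by blast
    also have "card (I s k) = k" by (simp add: I_def)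
    \<comment> \<open>One sign \<open>(-1) ^ k\<close> stems from the functional equation and one
      from the argument of \<open>L\<close>; their product is 1, so all solutions satisfy the same
      equation.\<close>
    finally have "euler_prod (map b [1..<q+1]) (meijer_sol L b q n s k) z = - ((-1) ^ k * ((-1) ^ k * z) * F s k (?M z))" .
    also have "\<dots> = z * meijer_sol L b q n s k z"
      by (simp add: sol[OF sk] mult.assoc[symmetric])
    finally show ?thesis by (simp only: diff_self)
  qed
  have indep: "c s k = 0"
    if zero: "\<forall>\<zeta>\<in>D. (\<Sum>s=1..r. \<Sum>k=1..n s. c s k * meijer_sol L b q n s k \<zeta>) = 0"
      and s: "s \<in> {1..r}" and k: "k \<in> {1..n s}" for c :: "nat \<Rightarrow> nat \<Rightarrow> complex" and s k
  proof -
    obtain z1 where z1: "z1 \<in> D" using D_ne by blast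
    have L1: "(L has_field_derivative inverse z) (at z)" if "z \<in> D" for z
      using L_deriv[OF that, of 0] by simp
    \<comment> \<open>\<open>L ((-1) ^ k * z)\<close> and \<open>L z\<close> have the same
      derivative on the connected set \<open>D\<close>, so they differ by a constant, read off at
      \<open>z1\<close>.\<close>
    define \<tau> where "\<tau> k = L ((-1) ^ k * z1) - L z1" for k :: nat
    have L_shift: "L ((-1) ^ k * z) = L z + \<tau> k" if z: "z \<in> D" for z and k :: nat
    proof -
      have d: "((\<lambda>z. L ((-1) ^ k * z) - L z) has_field_derivative 0) (at z)" if "z \<in> D" for z
        using DERIV_diff[OF L_deriv[OF that, of k] L1[OF that]] by simp
      have "(\<lambda>z. L ((-1) ^ k * z) - L z) constant_on D"
        by (rule has_field_derivative_0_imp_constant_on[OF d D_conn D_open])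
      then have "L ((-1) ^ k * z) - L z = L ((-1) ^ k * z1) - L z1"
        using z z1 unfolding constant_on_def by metis
      then show ?thesis by (simp add: \<tau>_def algebra_simps)
    qed
    define G where "G l = (\<Sum>s=1..r. \<Sum>k=1..n s. c s k * F s k (l + \<tau> k))" for l
    have "F s k holomorphic_on UNIV" if "s \<in> {1..r}" "k \<in> {1..n s}" for s k
      using F_deriv[OF that] by (simp add: holomorphic_on_open)
    then have "(F s k \<circ> (\<lambda>l. l + \<tau> k)) holomorphic_on UNIV" if "s \<in> {1..r}" "k \<in> {1..n s}" for s k
      using that by (intro holomorphic_on_compose_gen[of _ _ "F s k" UNIV]) (auto intro!: holomorphic_intros)
    then have G_hol: "G holomorphic_on UNIV"
      unfolding G_def[abs_def] by (intro holomorphic_intros) (auto simp: o_def)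
    have G_zero: "G (L z) = 0" if z: "z \<in> D" for z
    proof -
      have "G (L z) = - (\<Sum>s=1..r. \<Sum>k=1..n s. c s k * meijer_sol L b q n s k z)"
        unfolding G_def sum_negf[symmetric] by (intro sum.cong refl) (simp add: sol L_shift[OF z])
      then show ?thesis using zero z by simp
    qed
    \<comment> \<open>\<open>exp\<close> is a left inverse of \<open>L\<close>, so \<open>L\<close>
      is injective and maps \<open>D\<close> onto an open set. The identity theorem extends the
      relation from this image to all \<open>l\<close>, which makes the shift by 2\<pi>i available
      although the values of one branch need not contain it.\<close>
    have "open (L ` D)"
    proof (rule open_mapping_thm3)
      show "L holomorphic_on D" using L1 D_open by (auto simp: holomorphic_on_open)
      show "inj_on L D"
      proof (rule inj_onI)
        fix x y assume "x \<in> D" "y \<in> D" "L x = L y"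
        then show "x = y" using L_exp cut[of _ 0] by (metis mult_1 power_0)
      qed
    qed (rule D_open)
    then have "L z1 islimpt L ` D" using z1 by (intro interior_limit_point) (auto simp: interior_open)
    then have G0: "G l = 0" for l
      using analytic_continuation[OF G_hol, of "L ` D" "L z1" l] G_zero by auto
    show ?thesis
    proof (rule gamma_residue_sums_independent[OF J, where I = I and \<beta> = "\<lambda>s k. b (N s + k)" and
          \<alpha> = "\<lambda>s. b (N s + 1)" and \<tau> = \<tau> and c = c and r = r and n = n and b = b])
      show "(\<Sum>s=1..r. \<Sum>k=1..n s. c s k *
        residue_sum (b (N s + k)) (\<lambda>\<omega>. gamma_quot b (I s k) J \<omega> * exp (\<omega> * (l + \<tau> k)))) = 0" for l
        using G0[of l] by (simp add: G_def F_def)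
      show "card (I s k) = k" for s k by (simp add: I_def)
      show "1 - b j + b (N s + 1) \<notin> \<int>\<^sub>\<le>\<^sub>0" if "s \<in> {1..r}" "k \<in> {1..n s}" "j \<in> J - I s k" for s k j
        using \<alpha>_not_nonpos[of s j] that by (simp add: algebra_simps)
      show "b (N s + 1) - b (N s' + 1) \<notin> \<int>" if "s \<in> {1..r}" "s' \<in> {1..r}" "s \<noteq> s'" for s s'
        using block_Int[OF that(1,2), of 1 1] that n_pos by auto
    qed (use I_sub \<beta>_Nats \<alpha>_Nats s k in auto)
  qed
  have first: "meijer_sol L b q n s 1 \<zeta> =
              exp (b (blk_start n s + 1) * L (- \<zeta>))
              / (\<Prod>j'=1..q. Gamma (1 + b (blk_start n s + 1) - b j'))
              * hyp0F (map (\<lambda>j. 1 + b (blk_start n s + 1) - b j)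
                          (filter (\<lambda>j. j \<noteq> blk_start n s + 1) [1..<q+1])) \<zeta>"
    if s: "s \<in> {1..r}" and \<zeta>: "- \<zeta> \<notin> log_cut w" for s \<zeta>
  proof -
    have n1: "1 \<in> {1..n s}" using n_pos s by auto
    have I1: "I s 1 = {N s + 1}" by (auto simp: I_def)
    have mem: "N s + 1 \<in> J" using I_sub[OF s n1] I1 by auto
    have x: "exp (L (- \<zeta>)) = - \<zeta>" using L_exp \<zeta> by blast
    have "meijer_sol L b q n s 1 \<zeta> =
        - residue_sum (b (N s + 1)) (\<lambda>\<omega>. gamma_quot b {N s + 1} J \<omega> * exp (\<omega> * L (- \<zeta>)))"
      using sol[OF s n1, of \<zeta>] unfolding F_def I1 by simp
    also have "\<dots> = exp (b (N s + 1) * L (- \<zeta>)) / (\<Prod>j\<in>J. Gamma (1 + b (N s + 1) - b j)) *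
       (\<Sum>k. \<zeta> ^ k / (fact k * (\<Prod>j\<in>J - {N s + 1}. pochhammer (1 + b (N s + 1) - b j) k)))"
      by (rule residue_sum_single_gamma[OF J(1) mem _ x]) (rule \<alpha>_not_nonpos[OF s])
    finally have *: "meijer_sol L b q n s 1 \<zeta> = exp (b (N s + 1) * L (- \<zeta>)) / (\<Prod>j\<in>J. Gamma (1 + b (N s + 1) - b j)) *
       (\<Sum>k. \<zeta> ^ k / (fact k * (\<Prod>j\<in>J - {N s + 1}. pochhammer (1 + b (N s + 1) - b j) k)))" .
    have "J - {N s + 1} = set (filter (\<lambda>j. j \<noteq> N s + 1) [1..<q+1])" by (auto simp: J_def)
    then have "(\<Prod>j\<in>J - {N s + 1}. pochhammer (1 + b (N s + 1) - b j) k) =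
        (\<Prod>\<beta>\<leftarrow>map (\<lambda>j. 1 + b (N s + 1) - b j) (filter (\<lambda>j. j \<noteq> N s + 1) [1..<q+1]). pochhammer \<beta> k)" for k
      unfolding map_map o_def by (simp only: prod.distinct_set_conv_list[OF distinct_filter[OF distinct_upt]])
    then show ?thesis using * by (simp only: hyp0F_def J_def N_def)
  qed
  show ?thesis
    by (intro conjI ballI allI impI) (fact sol_hol sol_ode | erule (2) indep | erule (1) first)+
qed

end
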